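(* The topological group $\mathrm{Diff}_+^1(\mathbb{S}^1)$ is quasi-isometric to $Z=\{F\in C[0,1]:F(0)=0 \text{ and } F(1)=0\}$ (with the supremum-norm metric) via the mapping $\Phi_1$ given by $\Phi_1(f)=\log f'-\log f'(0)$. That is, $\Phi_1:\mathrm{Diff}_+^1(\mathbb{S}^1)\to Z$ is a quasi-isometry when $\mathrm{Diff}_+^1(\mathbb{S}^1)$ is equipped with any metric representing its quasi-isometry class as a topological group.
   Context: $\mathbb{S}^1$ is the circle, viewed as $[0,1]$ with $0$ and $1$ identified, with distance $d_{\mathbb{S}^1}([x],[y])=|e^{2\pi i x}-e^{2\pi i y}|$. An orientation-preserving homeomorphism $f$ of $\mathbb{S}^1$ has a unique lift $\tilde f:\mathbb{R}\to\mathbb{R}$ with $\tilde f(0)\in[0,1)$, $\tilde f(x+1)=\tilde f(x)+1$ and $f(x\bmod 1)=\tilde f(x)\bmod 1$; $f$ is of class $C^1$ iff $\tilde f$ is, and $f'(x)=\tilde f'(x)$. $\mathrm{Diff}_+^1(\mathbb{S}^1)$ is the group (under composition) of orientation-preserving $C^1$-diffeomorphisms of $\mathbb{S}^1$ with the topology induced by $\rho_1(f,g)=\sup_{x\in\mathbb{S}^1}d_{\mathbb{S}^1}(f(x),g(x))+\sup_{x\in\mathbb{S}^1}|f'(x)-g'(x)|$. In $\Phi_1(f)$ the derivative $f'$ is regarded as a function on $[0,1]$ (so $f'(0)=f'(1)$). $C[0,1]$ is the space of real-valued continuous functions on $[0,1]$ with the supremum norm. A subset $\Sigma$ of a separable metrizable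 group $G$ has the property (OB) relative to $G$ if $\Sigma$ has finite diameter with respect to every right-invariant metric on $G$ compatible with the topology of $G$. (For a connected Polish group $G$, such as $\mathrm{Diff}_+^1(\mathbb{S}^1)$, this is equivalent to: for every open neighborhood $U$ of the identity there is a positive integer $r$ with $\Sigma\subseteq U^r$.) If $G$ is generated by an open subset with the property (OB) relative to $G$ (which is the case for $\mathrm{Diff}_+^1(\mathbb{S}^1)$), the quasi-isometry class of $G$ as a topological group is represented by the right Cayley metrics $d_\Sigma(f,g)=\min\{n\geq 0: fg^{-1}\in\Sigma^n\}$ (with $\Sigma^0=\{e\}$), where $\Sigma$ is an open symmetric generating set with the property (OB) relative to $G$; by results of Rosendal these are mutually quasi-isometric via the identity map. A metric on $G$ represents this class if the identity map of $G$ is a quasi-isometry between it and such a $d_\Sigma$. A map $\phi:(X,d_X)\to(Y,d_Y)$ of metric spaces is a quasi-isometry if there are $L\geq1$, $C\geq0$ with $\frac1L d_X(x,x')-C\leq d_Y(\phi(x),\phi(x'))\leq L d_X(x,x')+C$ for all $x,x'\in X$ and every point of $Y$ is within distance $C$ of $\phi(X)$. *)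

theory Defs
  imports "HOL-Analysis.Analysis" "HOL-Algebra.Bij" "HOL-Algebra.Generated_Groups"
begin

section \<open>Quasi-isometries\<close>

definition quasi_isometry ::
  "'a set \<Rightarrow> ('a \<Rightarrow> 'a \<Rightarrow> real) \<Rightarrow> 'b set \<Rightarrow> ('b \<Rightarrow> 'b \<Rightarrow> real) \<Rightarrow> ('a \<Rightarrow> 'b) \<Rightarrow> bool"
  where
  "quasi_isometry X dX Y dY \<phi> \<longleftrightarrow>
     \<phi> \<in> X \<rightarrow> Y \<and>
     (\<exists>L C. 1 \<le> L \<and> 0 \<le> C \<and>
        (\<forall>x\<in>X. \<forall>x'\<in>X. 1 / L * dX x x' - C \<le> dY (\<phi> x) (\<phi> x') \<and>
                      dY (\<phi> x) (\<phi> x') \<le> L * dX x x' + C) \<and>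
        (\<forall>y\<in>Y. \<exists>x\<in>X. dY y (\<phi> x) \<le> C))"


section \<open>The quasi-isometry class of a topological group\<close>

text \<open>A topological group is given by a group \<open>G\<close> and a topology \<open>T\<close> on \<open>carrier G\<close>.\<close>

definition compatible_right_invariant_metric ::
  "('a, 'm) monoid_scheme \<Rightarrow> 'a topology \<Rightarrow> ('a \<Rightarrow> 'a \<Rightarrow> real) \<Rightarrow> bool"
  where
  "compatible_right_invariant_metric G T d \<longleftrightarrow>
     Metric_space (carrier G) d \<and>
     Metric_space.mtopology (carrier G) d = T \<and>
     (\<forall>x\<in>carrier G. \<forall>y\<in>carrier G. \<forall>z\<in>carrier G. d (x \<otimes>\<^bsub>G\<^esub> z) (y \<otimes>\<^bsub>G\<^esub> z) = d x y)"

definition property_OB :: "('a, 'm) monoid_scheme \<Rightarrow> 'a topology \<Rightarrow> 'a set \<Rightarrow> bool"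
  where
  "property_OB G T S \<longleftrightarrow>
     S \<subseteq> carrier G \<and>
     (\<forall>d. compatible_right_invariant_metric G T d \<longrightarrow> (\<exists>K. \<forall>x\<in>S. \<forall>y\<in>S. d x y \<le> K))"

primrec set_power :: "('a, 'm) monoid_scheme \<Rightarrow> 'a set \<Rightarrow> nat \<Rightarrow> 'a set"
  where
  "set_power G S 0 = {\<one>\<^bsub>G\<^esub>}"
| "set_power G S (Suc n) = set_power G S n <#>\<^bsub>G\<^esub> S"

definition open_symmetric_OB_generating ::
  "('a, 'm) monoid_scheme \<Rightarrow> 'a topology \<Rightarrow> 'a set \<Rightarrow> bool"
  where
  "open_symmetric_OB_generating G T S \<longleftrightarrow>
     openin T S \<and> set_inv\<^bsub>G\<^esub> S = S \<and> generate G S = carrier G \<and> property_OB G T S"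

definition right_cayley_dist :: "('a, 'm) monoid_scheme \<Rightarrow> 'a set \<Rightarrow> 'a \<Rightarrow> 'a \<Rightarrow> real"
  where
  "right_cayley_dist G S f g = real (LEAST n. f \<otimes>\<^bsub>G\<^esub> inv\<^bsub>G\<^esub> g \<in> set_power G S n)"

definition represents_quasi_isometry_class ::
  "('a, 'm) monoid_scheme \<Rightarrow> 'a topology \<Rightarrow> ('a \<Rightarrow> 'a \<Rightarrow> real) \<Rightarrow> bool"
  where
  "represents_quasi_isometry_class G T d \<longleftrightarrow>
     Metric_space (carrier G) d \<and>
     (\<exists>S. open_symmetric_OB_generating G T S \<and>
          quasi_isometry (carrier G) d (carrier G) (right_cayley_dist G S) (\<lambda>f. f))"


section \<open>Orientation-preserving diffeomorphisms of the circle\<close>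

text \<open>The point \<open>[x]\<close> of \<open>[0,1]\<close> with \<open>0\<close> and \<open>1\<close> identified is represented by
  \<open>exp (2 \<pi> \<i> x)\<close>, so that the distance on the circle is the ambient one of the complex numbers.\<close>

definition circle :: "complex set"
  where "circle = sphere 0 1"

definition circle_point :: "real \<Rightarrow> complex"
  where "circle_point x = exp (2 * of_real pi * \<i> * of_real x)"

definition is_lift :: "(complex \<Rightarrow> complex) \<Rightarrow> (real \<Rightarrow> real) \<Rightarrow> bool"
  where
  "is_lift f F \<longleftrightarrow>
     continuous_on UNIV F \<and> 0 \<le> F 0 \<and> F 0 < 1 \<and>
     (\<forall>x. F (x + 1) = F x + 1) \<and>
     (\<forall>x. f (circle_point x) = circle_point (F x))"

definition lift :: "(complex \<Rightarrow> complex) \<Rightarrow> real \<Rightarrow> real"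
  where "lift f = (THE F. is_lift f F)"

lemma is_lift_unique:
  assumes F: "is_lift f F" and G: "is_lift f G"
  shows "F = G"
proof -
  have int: "F x - G x \<in> \<int>" for x
  proof -
    have "exp (2 * of_real pi * \<i> * of_real (F x)) =
          (exp (2 * of_real pi * \<i> * of_real (G x)) :: complex)"
      using F G unfolding is_lift_def circle_point_def by metis
    then obtain n :: int where
      "2 * of_real pi * \<i> * of_real (F x) =
       2 * of_real pi * \<i> * of_real (G x) + (of_int (2 * n) * pi) * (\<i> :: complex)"
      by (auto simp: exp_eq)
    then have "2 * pi * F x = 2 * pi * G x + 2 * n * pi"
      by (simp add: complex_eq_iff)
    then have "pi * (2 * (F x - G x)) = pi * (2 * of_int n)"
      by (simp add: algebra_simps)
    then have "F x - G x = of_int n"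
      by simp
    then show ?thesis by simp
  qed
  have "(\<lambda>x. F x - G x) constant_on UNIV"
  proof (rule continuous_discrete_range_constant)
    show "continuous_on UNIV (\<lambda>x. F x - G x)"
      using F G unfolding is_lift_def by (intro continuous_intros) auto
    show "\<exists>e>0. \<forall>y. y \<in> UNIV \<and> F y - G y \<noteq> F x - G x \<longrightarrow> e \<le> norm (F y - G y - (F x - G x))" for x
    proof (intro exI[of _ 1] conjI allI impI)
      fix y assume "y \<in> UNIV \<and> F y - G y \<noteq> F x - G x"
      moreover have "F y - G y - (F x - G x) \<in> \<int>"
        by (rule Ints_diff[OF int int])
      ultimately show "1 \<le> norm (F y - G y - (F x - G x))"
        using Ints_nonzero_abs_ge1 by force
    qed simp
  qed simp
  then obtain c where c: "F x - G x = c" for x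
    unfolding constant_on_def by blast
  have "\<bar>F 0 - G 0\<bar> < 1"
    using F G unfolding is_lift_def by linarith
  then have "F 0 - G 0 = 0"
    using Ints_nonzero_abs_less1[OF int] by blast
  then show ?thesis using c by (metis diff_eq_eq add_0 ext)
qed

text \<open>As in \<^term>\<open>Bij\<close>, maps of the circle are extensional functions.\<close>

definition homeo_plus :: "(complex \<Rightarrow> complex) set"
  where
  "homeo_plus =
     {f \<in> extensional circle.
        (\<exists>g. homeomorphism circle circle f g) \<and> (\<exists>F. is_lift f F \<and> strict_mono F)}"

definition diff1_plus :: "(complex \<Rightarrow> complex) set"
  where
  "diff1_plus =
     {f \<in> homeo_plus. lift f C1_differentiable_on UNIV \<and>
                      lift (inv\<^bsub>BijGroup circle\<^esub> f) C1_differentiable_on UNIV}"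

definition Diff1_plus :: "(complex \<Rightarrow> complex) monoid"
  where "Diff1_plus = (BijGroup circle)\<lparr>carrier := diff1_plus\<rparr>"

definition circle_deriv :: "(complex \<Rightarrow> complex) \<Rightarrow> real \<Rightarrow> real"
  where "circle_deriv f x = deriv (lift f) x"

text \<open>The value \<open>0\<close> off \<^term>\<open>diff1_plus\<close> is needed because
  \<^term>\<open>Metric_space\<close> asks for nonnegativity and symmetry on the whole type.\<close>

definition rho1 :: "(complex \<Rightarrow> complex) \<Rightarrow> (complex \<Rightarrow> complex) \<Rightarrow> real"
  where
  "rho1 f g =
     (if f \<in> diff1_plus \<and> g \<in> diff1_plus
      then (SUP z\<in>circle. dist (f z) (g z)) +
           (SUP x\<in>{0..1}. \<bar>circle_deriv f x - circle_deriv g x\<bar>)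
      else 0)"

lemma Metric_space_rho1: "Metric_space diff1_plus rho1"
proof -
  define A where "A f g = (SUP z\<in>circle. dist (f z) (g z))" for f g :: "complex \<Rightarrow> complex"
  define B where "B f g = (SUP x\<in>{0..1}. \<bar>circle_deriv f x - circle_deriv g x\<bar>)" for f g
  have ne: "circle \<noteq> {}" "{0..1::real} \<noteq> {}"
    by (auto simp: circle_def)
  have in_circle: "f z \<in> circle" if "f \<in> diff1_plus" "z \<in> circle" for f z
    using that unfolding diff1_plus_def homeo_plus_def homeomorphism_def by blast
  have bddA: "bdd_above ((\<lambda>z. dist (f z) (g z)) ` circle)"
    if f: "f \<in> diff1_plus" and g: "g \<in> diff1_plus" for f g
  proof (rule bdd_aboveI2)
    fix z assume z: "z \<in> circle"
    have "dist (f z) (g z) \<le> norm (f z) + norm (g z)"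
      by (simp add: dist_norm norm_triangle_ineq4)
    also have "\<dots> = 2"
      using in_circle[OF f z] in_circle[OF g z] by (simp add: circle_def)
    finally show "dist (f z) (g z) \<le> 2" .
  qed
  have cont: "continuous_on {0..1} (circle_deriv f)" if f: "f \<in> diff1_plus" for f
  proof -
    obtain D where D: "\<And>x. (lift f has_vector_derivative D x) (at x)" "continuous_on UNIV D"
      using f unfolding diff1_plus_def C1_differentiable_on_def by auto
    have "circle_deriv f x = D x" for x
      unfolding circle_deriv_def
      using D(1) by (intro DERIV_imp_deriv) (simp add: has_real_derivative_iff_has_vector_derivative)
    then have "circle_deriv f = D" by blast
    then show ?thesis using D(2) continuous_on_subset by blast
  qed
  have bddB: "bdd_above ((\<lambda>x. \<bar>circle_deriv f x - circle_deriv g x\<bar>) ` {0..1})"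
    if f: "f \<in> diff1_plus" and g: "g \<in> diff1_plus" for f g
  proof -
    have "continuous_on {0..1} (\<lambda>x. \<bar>circle_deriv f x - circle_deriv g x\<bar>)"
      using cont[OF f] cont[OF g] by (intro continuous_intros)
    then show ?thesis
      by (intro bounded_imp_bdd_above compact_imp_bounded compact_continuous_image) auto
  qed
  have leA: "dist (f z) (g z) \<le> A f g"
    if "f \<in> diff1_plus" "g \<in> diff1_plus" "z \<in> circle" for f g z
    unfolding A_def using that by (intro cSUP_upper bddA)
  have leB: "\<bar>circle_deriv f x - circle_deriv g x\<bar> \<le> B f g"
    if "f \<in> diff1_plus" "g \<in> diff1_plus" "x \<in> {0..1}" for f g x
    unfolding B_def using that by (intro cSUP_upper bddB)
  have nonnegA: "0 \<le> A f g" if "f \<in> diff1_plus" "g \<in> diff1_plus" for f g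
  proof -
    obtain z where "z \<in> circle" using ne by blast
    from leA[OF that this] show ?thesis using zero_le_dist order_trans by blast
  qed
  have nonnegB: "0 \<le> B f g" if "f \<in> diff1_plus" "g \<in> diff1_plus" for f g
    using leB[OF that, of 0] by (simp add: order_trans[OF abs_ge_zero])
  have rho: "rho1 f g = (if f \<in> diff1_plus \<and> g \<in> diff1_plus then A f g + B f g else 0)" for f g
    by (simp add: rho1_def A_def B_def)
  show ?thesis
  proof
    show "0 \<le> rho1 f g" for f g
      using nonnegA nonnegB by (simp add: rho)
    show "rho1 f g = rho1 g f" for f g
      by (simp add: rho A_def B_def dist_commute abs_minus_commute)
    show "rho1 f g = 0 \<longleftrightarrow> f = g" if f: "f \<in> diff1_plus" and g: "g \<in> diff1_plus" for f g
    proof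
      assume "rho1 f g = 0"
      then have "A f g = 0"
        using nonnegA[OF f g] nonnegB[OF f g] by (simp add: rho f g)
      then have eq: "f z = g z" if "z \<in> circle" for z
        using leA[OF f g that] by simp
      show "f = g"
        using f g eq unfolding diff1_plus_def homeo_plus_def
        by (intro extensionalityI[of f circle g]) auto
    next
      assume "f = g"
      then show "rho1 f g = 0" using ne by (simp add: rho A_def B_def)
    qed
    show "rho1 f h \<le> rho1 f g + rho1 g h"
      if f: "f \<in> diff1_plus" and g: "g \<in> diff1_plus" and h: "h \<in> diff1_plus" for f g h
    proof -
      have "A f h \<le> A f g + A g h"
        unfolding A_def[of f h]
      proof (rule cSUP_least[OF ne(1)])
        fix z assume z: "z \<in> circle"
        show "dist (f z) (h z) \<le> A f g + A g h"
          using leA[OF f g z] leA[OF g h z] dist_triangle[of "f z" "h z" "g z"] by linarith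
      qed
      moreover have "B f h \<le> B f g + B g h"
        unfolding B_def[of f h]
      proof (rule cSUP_least[OF ne(2)])
        fix x :: real assume x: "x \<in> {0..1}"
        show "\<bar>circle_deriv f x - circle_deriv h x\<bar> \<le> B f g + B g h"
          using leB[OF f g x] leB[OF g h x] by linarith
      qed
      ultimately show ?thesis by (simp add: rho f g h)
    qed
  qed
qed

definition Diff1_topology :: "(complex \<Rightarrow> complex) topology"
  where "Diff1_topology = Metric_space.mtopology diff1_plus rho1"


section \<open>The space \<open>Z\<close> and the map \<open>\<Phi>\<^sub>1\<close>\<close>

definition C01 :: "(real \<Rightarrow> real) metric"
  where "C01 = cfunspace (top_of_set {0..1}) euclidean_metric"

definition Z_space :: "(real \<Rightarrow> real) metric"
  where "Z_space = submetric C01 {F. F 0 = 0 \<and> F 1 = 0}"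

definition Phi1 :: "(complex \<Rightarrow> complex) \<Rightarrow> real \<Rightarrow> real"
  where "Phi1 f = (\<lambda>x\<in>{0..1}. ln (circle_deriv f x) - ln (circle_deriv f 0))"

end

theory Submission
  imports Defs
begin

text \<open>
  Write \<open>L f\<close> for \<open>log f'\<close>.  The chain rule \<open>L (f \<circ> h) = L f \<circ> h + L h\<close> shows that
  \<open>sup \<bar>L f - L g\<bar>\<close>, increased by the uniform distance of \<open>f\<close> and \<open>g\<close> on the circle, is a right-invariant
  metric on the diffeomorphism group (\<open>log_rho\<close>).  It induces the \<open>C\<^sup>1\<close> topology
  (\<open>mtopology_log_rho\<close>).  Everything follows from two properties of this metric.

  First, \<open>\<Phi>\<^sub>1\<close> is a surjective quasi-isometry from it to \<open>Z\<close>.  The bound on \<open>\<Phi>\<^sub>1\<close> is immediate.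
  Conversely, derivatives of circle diffeomorphisms have mean 1, so \<open>f'\<close> and \<open>g'\<close> agree somewhere and
  \<open>L f - L g\<close> has a zero; its supremum is then at most its oscillation, which is at most
  \<open>2 \<parallel>\<Phi>\<^sub>1 f - \<Phi>\<^sub>1 g\<parallel>\<close> (\<open>log_deriv_diff_le_oscillation\<close>).  Any element of \<open>Z\<close> is attained by
  normalising the integral of its exponential (\<open>diff1_plus_with_log_deriv\<close>).

  Secondly, it is large-scale geodesic.  The diffeomorphism with \<open>L f\<close> equal to \<open>t L h\<close> up to a constant,
  and with the rotation part of \<open>h\<close> scaled by \<open>t\<close>, runs from the identity to \<open>h\<close> as \<open>t\<close> goes from 0
  to 1, with speed at most a constant multiple of 1 plus the distance of \<open>h\<close> from the identity; cutting this path into equal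
  pieces gives short chains (\<open>diff1_plus_path\<close>, \<open>large_scale_geodesic_log_rho\<close>).

  In any group such a metric represents the quasi-isometry class and is quasi-isometric to every other
  representative.  If \<open>S\<close> is an open symmetric generating set with the property (OB), then \<open>S\<close> is bounded
  and \<open>S S\<close> contains a ball around the identity, so that chains of short steps are words in \<open>S\<close>, and the
  word length in \<open>S\<close> is comparable with the metric (\<open>right_cayley_dist_comparable\<close>).  The unit ball is such a
  set \<open>S\<close> (\<open>unit_nbhd_one_open_symmetric_OB_generating\<close>).
\<close>


section \<open>Quasi-isometries\<close>

lemma quasi_isometry_compose:
  assumes "quasi_isometry X dX Y dY f" and "quasi_isometry Y dY Z dZ g" and "Metric_space Z dZ"
  shows "quasi_isometry X dX Z dZ (\<lambda>x. g (f x))"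
proof -
  interpret Metric_space Z dZ by fact
  from assms(1) obtain L C where f: "f \<in> X \<rightarrow> Y" and LC: "1 \<le> L" "0 \<le> C"
    and fl: "\<And>x x'. x \<in> X \<Longrightarrow> x' \<in> X \<Longrightarrow> 1 / L * dX x x' - C \<le> dY (f x) (f x')"
    and fu: "\<And>x x'. x \<in> X \<Longrightarrow> x' \<in> X \<Longrightarrow> dY (f x) (f x') \<le> L * dX x x' + C"
    and fs: "\<And>y. y \<in> Y \<Longrightarrow> \<exists>x\<in>X. dY y (f x) \<le> C"
    unfolding quasi_isometry_def by blast
  from assms(2) obtain M D where g: "g \<in> Y \<rightarrow> Z" and MD: "1 \<le> M" "0 \<le> D"
    and gl: "\<And>x x'. x \<in> Y \<Longrightarrow> x' \<in> Y \<Longrightarrow> 1 / M * dY x x' - D \<le> dZ (g x) (g x')"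
    and gu: "\<And>x x'. x \<in> Y \<Longrightarrow> x' \<in> Y \<Longrightarrow> dZ (g x) (g x') \<le> M * dY x x' + D"
    and gs: "\<And>y. y \<in> Z \<Longrightarrow> \<exists>x\<in>Y. dZ y (g x) \<le> D"
    unfolding quasi_isometry_def by blast
  define K where "K = M * C + 2 * D"
  have MC: "C \<le> M * C" using LC MD mult_right_mono[of 1 M C] by simp
  have CM: "C / M \<le> C" using LC MD by (simp add: divide_le_eq mult_le_cancel_left1)
  have K: "0 \<le> K" "C / M + D \<le> K" "M * C + D \<le> K"
    using LC MD MC CM unfolding K_def by auto
  show ?thesis
    unfolding quasi_isometry_def
  proof (rule conjI, (use f g in auto)[1], rule exI[of _ "L * M"], rule exI[of _ K], intro conjI ballI)
    show "1 \<le> L * M" using LC MD mult_mono[of 1 L 1 M] by simp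
    show "0 \<le> K" by (rule K)
  next
    fix x x' assume x: "x \<in> X" "x' \<in> X"
    have y: "f x \<in> Y" "f x' \<in> Y" using x f by auto
    have "1 / (L * M) * dX x x' - C / M = 1 / M * (1 / L * dX x x' - C)"
      by (simp add: algebra_simps)
    also have "\<dots> \<le> 1 / M * dY (f x) (f x')"
      using MD fl[OF x] by (intro mult_left_mono) auto
    also have "\<dots> \<le> dZ (g (f x)) (g (f x')) + D" using gl[OF y] by simp
    finally show "1 / (L * M) * dX x x' - K \<le> dZ (g (f x)) (g (f x'))" using K by simp
    have "dZ (g (f x)) (g (f x')) \<le> M * dY (f x) (f x') + D" by (rule gu[OF y])
    also have "\<dots> \<le> M * (L * dX x x' + C) + D"
      using MD fu[OF x] by (intro add_right_mono mult_left_mono) auto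
    also have "\<dots> = L * M * dX x x' + (M * C + D)" by (simp add: algebra_simps)
    finally show "dZ (g (f x)) (g (f x')) \<le> L * M * dX x x' + K" using K by simp
  next
    fix z assume z: "z \<in> Z"
    then obtain y where y: "y \<in> Y" "dZ z (g y) \<le> D" using gs by blast
    then obtain x where x: "x \<in> X" "dY y (f x) \<le> C" using fs by blast
    have "dZ (g y) (g (f x)) \<le> M * dY y (f x) + D" using gu y x f by auto
    also have "\<dots> \<le> M * C + D" using x MD by (simp add: mult_left_mono)
    finally have "dZ z (g (f x)) \<le> D + (M * C + D)"
      using triangle[of z "g y" "g (f x)"] z y x f g by (smt (verit) PiE)
    then show "\<exists>x\<in>X. dZ z (g (f x)) \<le> K" using x by (intro bexI[of _ x]) (auto simp: K_def)
  qed
qed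

lemma quasi_isometry_identity:
  assumes "\<And>x y. x \<in> X \<Longrightarrow> y \<in> X \<Longrightarrow> d x y \<le> K * d' x y + K"
    and "\<And>x y. x \<in> X \<Longrightarrow> y \<in> X \<Longrightarrow> d' x y \<le> K * d x y + K"
    and nonneg: "\<And>x y. x \<in> X \<Longrightarrow> y \<in> X \<Longrightarrow> 0 \<le> d x y"
    and nonneg': "\<And>x y. x \<in> X \<Longrightarrow> y \<in> X \<Longrightarrow> 0 \<le> d' x y"
    and refl: "\<And>x. x \<in> X \<Longrightarrow> d' x x = 0"
  shows "quasi_isometry X d X d' (\<lambda>x. x)"
proof -
  define L where "L = max 1 K"
  have L: "1 \<le> L" "K \<le> L" by (auto simp: L_def)
  show ?thesis
    unfolding quasi_isometry_def
  proof (intro conjI exI[of _ L] ballI)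
    fix x y assume x: "x \<in> X" "y \<in> X"
    have "d x y \<le> L * d' x y + L"
      using assms(1)[OF x] L nonneg'[OF x] by (smt (verit) mult_right_mono)
    then have "d x y / L \<le> d' x y + 1"
      using L by (simp add: field_simps)
    then show "1 / L * d x y - L \<le> d' x y" using L by simp
    show "d' x y \<le> L * d x y + L"
      using assms(2)[OF x] L nonneg[OF x] by (smt (verit) mult_right_mono)
  next
    fix x assume "x \<in> X"
    then show "\<exists>y\<in>X. d' x y \<le> L" using refl L by (intro bexI[of _ x]) auto
  qed (use L in auto)
qed


section \<open>Large-scale geodesic right-invariant metrics\<close>

text \<open>The identity and \<open>h\<close> are joined by a chain of steps shorter than \<open>\<epsilon>\<close>, and for fixed \<open>\<epsilon>\<close>
  the number of steps grows at most linearly with the distance.  By right invariance chains from the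
  identity give chains between any two points.\<close>

definition large_scale_geodesic ::
  "('a, 'm) monoid_scheme \<Rightarrow> ('a \<Rightarrow> 'a \<Rightarrow> real) \<Rightarrow> bool"
  where
  "large_scale_geodesic G d \<longleftrightarrow>
     (\<forall>\<epsilon>>0. \<exists>K\<ge>0. \<forall>h\<in>carrier G. \<exists>n c. real n \<le> K * d h \<one>\<^bsub>G\<^esub> + K \<and>
        c \<in> UNIV \<rightarrow> carrier G \<and> c 0 = \<one>\<^bsub>G\<^esub> \<and> c n = h \<and> (\<forall>i<n. d (c (Suc i)) (c i) < \<epsilon>))"

definition unit_nbhd :: "('a, 'm) monoid_scheme \<Rightarrow> ('a \<Rightarrow> 'a \<Rightarrow> real) \<Rightarrow> real \<Rightarrow> 'a set"
  where "unit_nbhd G d \<epsilon> = {g \<in> carrier G. d g \<one>\<^bsub>G\<^esub> < \<epsilon>}"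

lemma set_power_subset:
  assumes "group G" "S \<subseteq> carrier G"
  shows "set_power G S n \<subseteq> carrier G"
proof -
  interpret group G by fact
  show ?thesis using assms(2) by (induction n) (auto simp: set_mult_closed)
qed

lemma set_power_mono: "S \<subseteq> S' \<Longrightarrow> set_power G S n \<subseteq> set_power G S' n"
  by (induction n) (auto simp: mono_set_mult)

lemma set_power_Suc_left:
  assumes "group G" "S \<subseteq> carrier G"
  shows "set_power G S (Suc n) = S <#>\<^bsub>G\<^esub> set_power G S n"
proof -
  interpret group G by fact
  show ?thesis
  proof (induction n)
    case 0
    have "{\<one>\<^bsub>G\<^esub>} <#>\<^bsub>G\<^esub> S = S" "S <#>\<^bsub>G\<^esub> {\<one>\<^bsub>G\<^esub>} = S"
      using assms(2) unfolding set_mult_def by (force simp: subset_iff)+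
    then show ?case by simp
  next
    case (Suc n)
    have "set_power G S (Suc (Suc n)) = (S <#>\<^bsub>G\<^esub> set_power G S n) <#>\<^bsub>G\<^esub> S"
      using Suc by simp
    also have "\<dots> = S <#>\<^bsub>G\<^esub> (set_power G S n <#>\<^bsub>G\<^esub> S)"
      using assms by (intro set_mult_assoc set_power_subset)
    finally show ?case by simp
  qed
qed

lemma set_power_square:
  assumes "group G" "S \<subseteq> carrier G"
  shows "set_power G (S <#>\<^bsub>G\<^esub> S) n = set_power G S (2 * n)"
proof -
  interpret group G by fact
  show ?thesis
  proof (induction n)
    case (Suc n)
    then show ?case
      using assms set_power_subset[OF assms] by (simp add: set_mult_assoc)
  qed simp
qed

lemma compatible_right_invariant_metric_dist_quotient:
  assumes "group G" "compatible_right_invariant_metric G T d" "f \<in> carrier G" "g \<in> carrier G"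
  shows "d (f \<otimes>\<^bsub>G\<^esub> inv\<^bsub>G\<^esub> g) \<one>\<^bsub>G\<^esub> = d f g"
proof -
  interpret group G by fact
  have "d (f \<otimes>\<^bsub>G\<^esub> inv\<^bsub>G\<^esub> g) (g \<otimes>\<^bsub>G\<^esub> inv\<^bsub>G\<^esub> g) = d f g"
    using assms unfolding compatible_right_invariant_metric_def by blast
  then show ?thesis using assms by simp
qed

text \<open>Right invariance makes the distance to the identity subadditive under products.\<close>

lemma set_power_dist_le:
  assumes G: "group G" and d: "compatible_right_invariant_metric G T d" and S: "S \<subseteq> carrier G"
    and K: "\<And>s. s \<in> S \<Longrightarrow> d s \<one>\<^bsub>G\<^esub> \<le> K"
    and h: "h \<in> set_power G S n"
  shows "d h \<one>\<^bsub>G\<^esub> \<le> K * real n"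
proof -
  interpret group G by fact
  interpret Metric_space "carrier G" d
    using d unfolding compatible_right_invariant_metric_def by blast
  show ?thesis
    using h
  proof (induction n arbitrary: h)
    case (Suc n)
    then obtain a s where a: "a \<in> set_power G S n" and s: "s \<in> S" and h: "h = a \<otimes>\<^bsub>G\<^esub> s"
      by (auto simp: set_mult_def)
    have ac: "a \<in> carrier G" and sc: "s \<in> carrier G"
      using a s S set_power_subset[OF G S] by auto
    have "d h s = d (a \<otimes>\<^bsub>G\<^esub> s) (\<one>\<^bsub>G\<^esub> \<otimes>\<^bsub>G\<^esub> s)" using sc h by simp
    also have "\<dots> = d a \<one>\<^bsub>G\<^esub>"
      using d ac sc unfolding compatible_right_invariant_metric_def by blast
    finally have "d h s \<le> K * real n" using Suc.IH[OF a] by simp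
    moreover have "d h \<one>\<^bsub>G\<^esub> \<le> d h s + d s \<one>\<^bsub>G\<^esub>" using ac sc h by (intro triangle) auto
    ultimately show ?case using K[OF s] by (simp add: algebra_simps)
  qed simp
qed

text \<open>The step quotients \<open>c (i + 1) (c i)\<^sup>-\<^sup>1\<close> telescope to \<open>c n\<close>, and by right invariance each of them
  lies as close to the identity as \<open>c (i + 1)\<close> does to \<open>c i\<close>.\<close>

lemma chain_in_set_power:
  assumes G: "group G" and d: "compatible_right_invariant_metric G T d"
    and c: "c \<in> UNIV \<rightarrow> carrier G" "c 0 = \<one>\<^bsub>G\<^esub>"
    and step: "\<And>i. i < n \<Longrightarrow> d (c (Suc i)) (c i) < \<epsilon>"
  shows "c n \<in> set_power G (unit_nbhd G d \<epsilon>) n"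
  using step
proof (induction n)
  case (Suc n)
  interpret group G by fact
  have cc: "c i \<in> carrier G" for i using c(1) by auto
  have "c (Suc n) \<otimes>\<^bsub>G\<^esub> inv\<^bsub>G\<^esub> c n \<in> unit_nbhd G d \<epsilon>"
    using compatible_right_invariant_metric_dist_quotient[OF G d cc cc, of "Suc n" n] Suc.prems cc
    by (simp add: unit_nbhd_def)
  moreover have "c n \<in> set_power G (unit_nbhd G d \<epsilon>) n" using Suc by simp
  moreover have "c (Suc n) = (c (Suc n) \<otimes>\<^bsub>G\<^esub> inv\<^bsub>G\<^esub> c n) \<otimes>\<^bsub>G\<^esub> c n"
    using cc by (simp add: m_assoc)
  ultimately have "c (Suc n) \<in> unit_nbhd G d \<epsilon> <#>\<^bsub>G\<^esub> set_power G (unit_nbhd G d \<epsilon>) n"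
    unfolding set_mult_def by blast
  also have "\<dots> = set_power G (unit_nbhd G d \<epsilon>) (Suc n)"
    by (rule set_power_Suc_left[OF G, symmetric]) (auto simp: unit_nbhd_def)
  finally show ?case .
qed (use c in simp)

lemma large_scale_geodesic_set_power:
  assumes "group G" "compatible_right_invariant_metric G T d" "large_scale_geodesic G d" "0 < \<epsilon>"
  obtains K where "0 \<le> K" and "\<And>h. h \<in> carrier G \<Longrightarrow>
    \<exists>n. real n \<le> K * d h \<one>\<^bsub>G\<^esub> + K \<and> h \<in> set_power G (unit_nbhd G d \<epsilon>) n"
proof -
  from assms(3)[unfolded large_scale_geodesic_def, THEN spec, THEN mp, OF assms(4)]
  obtain K where K: "0 \<le> K" and chain: "\<forall>h\<in>carrier G. \<exists>n c. real n \<le> K * d h \<one>\<^bsub>G\<^esub> + K \<and>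
        c \<in> UNIV \<rightarrow> carrier G \<and> c 0 = \<one>\<^bsub>G\<^esub> \<and> c n = h \<and> (\<forall>i<n. d (c (Suc i)) (c i) < \<epsilon>)"
    by (rule exE) (rule that, auto)
  show thesis
  proof (rule that[OF K])
    fix h assume "h \<in> carrier G"
    then obtain n c where "real n \<le> K * d h \<one>\<^bsub>G\<^esub> + K" and c: "c \<in> UNIV \<rightarrow> carrier G"
      "c 0 = \<one>\<^bsub>G\<^esub>" "c n = h" "\<forall>i<n. d (c (Suc i)) (c i) < \<epsilon>"
      using chain by metis
    moreover have "c n \<in> set_power G (unit_nbhd G d \<epsilon>) n"
      using c by (intro chain_in_set_power[OF assms(1,2)]) auto
    ultimately show "\<exists>n. real n \<le> K * d h \<one>\<^bsub>G\<^esub> + K \<and> h \<in> set_power G (unit_nbhd G d \<epsilon>) n"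
      by blast
  qed
qed

text \<open>A symmetric open set need not contain the identity, but a ball around some
  \<open>s \<in> S\<close> lies in \<open>S\<close>, and right translation by the inverse of \<open>s\<close>, which is also in \<open>S\<close>, carries it to a
  ball around the identity.\<close>

lemma symmetric_open_square_contains_unit_nbhd:
  assumes G: "group G" and d: "compatible_right_invariant_metric G T d"
    and S: "openin T S" "set_inv\<^bsub>G\<^esub> S = S" "s \<in> S"
  obtains \<epsilon> where "0 < \<epsilon>" "unit_nbhd G d \<epsilon> \<subseteq> S <#>\<^bsub>G\<^esub> S"
proof -
  interpret group G by fact
  interpret Metric_space "carrier G" d
    using d unfolding compatible_right_invariant_metric_def by blast
  have T: "mtopology = T" using d unfolding compatible_right_invariant_metric_def by blast
  have SG: "S \<subseteq> carrier G" using S(1) openin_subset unfolding T[symmetric] by fastforce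
  obtain \<epsilon> where e: "0 < \<epsilon>" "mball s \<epsilon> \<subseteq> S"
    using S unfolding T[symmetric] openin_mtopology by blast
  have "g \<in> S <#>\<^bsub>G\<^esub> S" if "g \<in> unit_nbhd G d \<epsilon>" for g
  proof -
    have g: "g \<in> carrier G" "d g \<one>\<^bsub>G\<^esub> < \<epsilon>" using that by (auto simp: unit_nbhd_def)
    have s: "s \<in> carrier G" using S SG by blast
    have "d (g \<otimes>\<^bsub>G\<^esub> s) (\<one>\<^bsub>G\<^esub> \<otimes>\<^bsub>G\<^esub> s) = d g \<one>\<^bsub>G\<^esub>"
      using d g s unfolding compatible_right_invariant_metric_def by blast
    then have "g \<otimes>\<^bsub>G\<^esub> s \<in> S" using g s e commute[of s] by (auto simp: subset_iff)
    moreover have "inv\<^bsub>G\<^esub> s \<in> S" using S unfolding SET_INV_def by blast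
    moreover have "g = (g \<otimes>\<^bsub>G\<^esub> s) \<otimes>\<^bsub>G\<^esub> inv\<^bsub>G\<^esub> s" using g s by (simp add: m_assoc)
    ultimately show ?thesis unfolding set_mult_def by blast
  qed
  then show thesis using that e by blast
qed

lemma right_cayley_dist_nonneg: "0 \<le> right_cayley_dist G S f g"
  by (simp add: right_cayley_dist_def)

lemma right_cayley_dist_self:
  assumes "group G" "f \<in> carrier G"
  shows "right_cayley_dist G S f f = 0"
proof -
  interpret group G by fact
  have "f \<otimes>\<^bsub>G\<^esub> inv\<^bsub>G\<^esub> f \<in> set_power G S 0" using assms by simp
  then show ?thesis unfolding right_cayley_dist_def by (metis Least_eq_0 of_nat_0)
qed

text \<open>A word of length \<open>n\<close> in \<open>S\<close> moves the identity by at most \<open>n\<close> times the bound that the property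
  (OB) puts on \<open>S\<close>.  In the other direction a chain with steps inside a small ball is a word over
  \<open>S S\<close>, hence a word over \<open>S\<close> of twice the length, and such chains are short.\<close>

lemma right_cayley_dist_comparable:
  assumes G: "group G" and d: "compatible_right_invariant_metric G T d"
    and lsg: "large_scale_geodesic G d" and S: "open_symmetric_OB_generating G T S"
  obtains K where
    "\<And>f g. f \<in> carrier G \<Longrightarrow> g \<in> carrier G \<Longrightarrow> d f g \<le> K * right_cayley_dist G S f g + K"
    "\<And>f g. f \<in> carrier G \<Longrightarrow> g \<in> carrier G \<Longrightarrow> right_cayley_dist G S f g \<le> K * d f g + K"
proof -
  interpret group G by fact
  interpret Metric_space "carrier G" d
    using d unfolding compatible_right_invariant_metric_def by blast
  have SG: "S \<subseteq> carrier G"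
    using S unfolding open_symmetric_OB_generating_def property_OB_def by blast
  obtain B where B: "0 \<le> B" "\<And>s. s \<in> S \<Longrightarrow> d s \<one>\<^bsub>G\<^esub> \<le> B"
  proof (cases "S = {}")
    case False
    then obtain s0 where s0: "s0 \<in> S" by blast
    obtain K where K: "\<And>x y. x \<in> S \<Longrightarrow> y \<in> S \<Longrightarrow> d x y \<le> K"
      using S d unfolding open_symmetric_OB_generating_def property_OB_def by blast
    show thesis
    proof (rule that[of "K + d s0 \<one>\<^bsub>G\<^esub>"])
      show "0 \<le> K + d s0 \<one>\<^bsub>G\<^esub>" using K[OF s0 s0] s0 SG by (simp add: subset_iff)
      fix s assume s: "s \<in> S"
      then show "d s \<one>\<^bsub>G\<^esub> \<le> K + d s0 \<one>\<^bsub>G\<^esub>"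
        using K[OF s s0] triangle[of s s0 "\<one>\<^bsub>G\<^esub>"] s0 SG by force
    qed
  qed (use that[of 0] in simp)
  \<comment> \<open>The empty set generates only the trivial group, where the empty word suffices.\<close>
  obtain K where K: "0 \<le> K"
    "\<And>h. h \<in> carrier G \<Longrightarrow> \<exists>n. real n \<le> K * d h \<one>\<^bsub>G\<^esub> + K \<and> h \<in> set_power G S n"
  proof (cases "S = {}")
    case True
    have "h = \<one>\<^bsub>G\<^esub>" if "h \<in> carrier G" for h
    proof -
      have "h \<in> generate G S"
        using S that unfolding open_symmetric_OB_generating_def by blast
      then show ?thesis by induction (auto simp: True)
    qed
    then show thesis by (intro that[of 0]) (auto intro!: exI[of _ 0])
  next
    case False
    then obtain \<epsilon> where e: "0 < \<epsilon>" "unit_nbhd G d \<epsilon> \<subseteq> S <#>\<^bsub>G\<^esub> S"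
      using symmetric_open_square_contains_unit_nbhd[OF G d] S
      unfolding open_symmetric_OB_generating_def by (metis ex_in_conv)
    obtain K where K: "0 \<le> K" "\<And>h. h \<in> carrier G \<Longrightarrow>
      \<exists>n. real n \<le> K * d h \<one>\<^bsub>G\<^esub> + K \<and> h \<in> set_power G (unit_nbhd G d \<epsilon>) n"
      using large_scale_geodesic_set_power[OF G d lsg e(1)] by blast
    show thesis
    proof (rule that[of "2 * K"])
      fix h assume h: "h \<in> carrier G"
      then obtain n where n: "real n \<le> K * d h \<one>\<^bsub>G\<^esub> + K" "h \<in> set_power G (unit_nbhd G d \<epsilon>) n"
        using K(2) by blast
      then have "h \<in> set_power G S (2 * n)"
        using set_power_mono[OF e(2)] set_power_square[OF G SG] by blast
      then show "\<exists>n. real n \<le> 2 * K * d h \<one>\<^bsub>G\<^esub> + 2 * K \<and> h \<in> set_power G S n"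
        using n(1) by (intro exI[of _ "2 * n"]) auto
    qed (use K in auto)
  qed
  show thesis
  proof (rule that[of "max B K"])
    fix f g assume fg: "f \<in> carrier G" "g \<in> carrier G"
    define h where "h = f \<otimes>\<^bsub>G\<^esub> inv\<^bsub>G\<^esub> g"
    have h: "h \<in> carrier G" using fg by (simp add: h_def)
    have dh: "d h \<one>\<^bsub>G\<^esub> = d f g"
      unfolding h_def by (rule compatible_right_invariant_metric_dist_quotient[OF G d fg])
    define m where "m = (LEAST n. h \<in> set_power G S n)"
    have rc: "right_cayley_dist G S f g = real m"
      by (simp add: right_cayley_dist_def h_def m_def)
    obtain n where n: "real n \<le> K * d f g + K" "h \<in> set_power G S n"
      using K(2)[OF h] dh by auto
    have m: "h \<in> set_power G S m" "m \<le> n"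
      unfolding m_def using n(2) by (rule LeastI, rule Least_le)
    have "d f g \<le> B * real m"
      using set_power_dist_le[OF G d SG B(2) m(1)] dh by simp
    also have "\<dots> \<le> max B K * real m + max B K"
      using B by (smt (verit) mult_right_mono of_nat_0_le_iff)
    finally show "d f g \<le> max B K * right_cayley_dist G S f g + max B K" by (simp add: rc)
    have "real m \<le> K * d f g + K" using m n by linarith
    also have "\<dots> \<le> max B K * d f g + max B K"
      using fg by (intro add_mono mult_right_mono) auto
    finally show "right_cayley_dist G S f g \<le> max B K * d f g + max B K" by (simp add: rc)
  qed
qed

text \<open>For the property (OB), let \<open>e\<close> be another compatible right-invariant metric.  Its unit ball
  contains some \<open>d\<close>-ball around the identity, and the elements at \<open>d\<close>-distance less than 1 are products
  of a bounded number of elements of that \<open>d\<close>-ball, each of which costs at most 1 in \<open>e\<close>.\<close>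

lemma unit_nbhd_one_open_symmetric_OB_generating:
  assumes G: "group G" and d: "compatible_right_invariant_metric G T d"
    and lsg: "large_scale_geodesic G d"
  shows "open_symmetric_OB_generating G T (unit_nbhd G d 1)"
proof -
  interpret group G by fact
  interpret Metric_space "carrier G" d
    using d unfolding compatible_right_invariant_metric_def by blast
  have T: "mtopology = T" using d unfolding compatible_right_invariant_metric_def by blast
  define U where "U = unit_nbhd G d 1"
  have UG: "U \<subseteq> carrier G" by (auto simp: U_def unit_nbhd_def)
  have U_ball: "U = mball \<one>\<^bsub>G\<^esub> 1"
    using commute by (auto simp: U_def unit_nbhd_def)
  have inv_U: "inv\<^bsub>G\<^esub> g \<in> U" if "g \<in> U" for g
  proof -
    have g: "g \<in> carrier G" using that UG by blast
    have "d (\<one>\<^bsub>G\<^esub> \<otimes>\<^bsub>G\<^esub> inv\<^bsub>G\<^esub> g) \<one>\<^bsub>G\<^esub> = d \<one>\<^bsub>G\<^esub> g"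
      by (rule compatible_right_invariant_metric_dist_quotient[OF G d _ g]) simp
    then show ?thesis using that g commute[of g] by (simp add: U_def unit_nbhd_def)
  qed
  have "openin T U" unfolding T[symmetric] U_ball by (rule openin_mball)
  moreover have "set_inv\<^bsub>G\<^esub> U = U"
  proof
    show "set_inv\<^bsub>G\<^esub> U \<subseteq> U" unfolding SET_INV_def using inv_U by blast
    show "U \<subseteq> set_inv\<^bsub>G\<^esub> U"
    proof
      fix g assume g: "g \<in> U"
      then have "g = inv\<^bsub>G\<^esub> (inv\<^bsub>G\<^esub> g)" using UG by auto
      then show "g \<in> set_inv\<^bsub>G\<^esub> U" unfolding SET_INV_def using inv_U[OF g] by blast
    qed
  qed
  moreover have "generate G U = carrier G"
  proof
    show "generate G U \<subseteq> carrier G" using UG by (rule generate_incl)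
    have "set_power G U n \<subseteq> generate G U" for n
      by (induction n) (auto simp: set_mult_def intro: generate.intros)
    then show "carrier G \<subseteq> generate G U"
      using large_scale_geodesic_set_power[OF G d lsg, of 1] unfolding U_def
      by (metis subset_iff zero_less_one)
  qed
  moreover have "\<exists>K. \<forall>x\<in>U. \<forall>y\<in>U. e x y \<le> K" if e: "compatible_right_invariant_metric G T e" for e
  proof -
    interpret e: Metric_space "carrier G" e
      using e unfolding compatible_right_invariant_metric_def by blast
    have "openin mtopology (e.mball \<one>\<^bsub>G\<^esub> 1)"
      using e d e.openin_mball unfolding compatible_right_invariant_metric_def by metis
    then obtain \<epsilon> where eps: "0 < \<epsilon>" "mball \<one>\<^bsub>G\<^esub> \<epsilon> \<subseteq> e.mball \<one>\<^bsub>G\<^esub> 1"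
      unfolding openin_mtopology by auto
    have small: "e s \<one>\<^bsub>G\<^esub> \<le> 1" if "s \<in> unit_nbhd G d \<epsilon>" for s
    proof -
      have "s \<in> mball \<one>\<^bsub>G\<^esub> \<epsilon>" using that commute by (simp add: unit_nbhd_def)
      then show ?thesis using eps(2) e.commute by (fastforce simp: subset_iff)
    qed
    obtain K where K: "0 \<le> K" "\<And>h. h \<in> carrier G \<Longrightarrow>
      \<exists>n. real n \<le> K * d h \<one>\<^bsub>G\<^esub> + K \<and> h \<in> set_power G (unit_nbhd G d \<epsilon>) n"
      using large_scale_geodesic_set_power[OF G d lsg eps(1)] by blast
    have bound: "e x \<one>\<^bsub>G\<^esub> \<le> 2 * K" if x: "x \<in> U" for x
    proof -
      have xG: "x \<in> carrier G" "d x \<one>\<^bsub>G\<^esub> < 1" using x by (auto simp: U_def unit_nbhd_def)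
      obtain n where n: "real n \<le> K * d x \<one>\<^bsub>G\<^esub> + K" "x \<in> set_power G (unit_nbhd G d \<epsilon>) n"
        using K(2)[OF xG(1)] by blast
      have "e x \<one>\<^bsub>G\<^esub> \<le> 1 * real n"
        by (rule set_power_dist_le[OF G e _ small n(2)]) (auto simp: unit_nbhd_def)
      also have "\<dots> \<le> K * 1 + K"
        using n(1) K(1) xG(2) mult_left_mono[of "d x \<one>\<^bsub>G\<^esub>" 1 K] by linarith
      finally show ?thesis by simp
    qed
    show ?thesis
    proof (intro exI[of _ "4 * K"] ballI)
      fix x y assume xy: "x \<in> U" "y \<in> U"
      then have "e x y \<le> e x \<one>\<^bsub>G\<^esub> + e \<one>\<^bsub>G\<^esub> y" using UG by (intro e.triangle) auto
      then show "e x y \<le> 4 * K"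
        using bound[OF xy(1)] bound[OF xy(2)] e.commute[of y] by simp
    qed
  qed
  ultimately show ?thesis
    using UG unfolding open_symmetric_OB_generating_def property_OB_def U_def[symmetric] by blast
qed

text \<open>Together with the next theorem: a compatible right-invariant metric that is large-scale geodesic
  represents the quasi-isometry class, and every representative is quasi-isometric to it by the identity.\<close>

theorem large_scale_geodesic_represents:
  assumes G: "group G" and d: "compatible_right_invariant_metric G T d"
    and lsg: "large_scale_geodesic G d"
  shows "represents_quasi_isometry_class G T d"
proof -
  interpret Metric_space "carrier G" d
    using d unfolding compatible_right_invariant_metric_def by blast
  note S = unit_nbhd_one_open_symmetric_OB_generating[OF G d lsg]
  obtain K where
    "\<And>f g. f \<in> carrier G \<Longrightarrow> g \<in> carrier G \<Longrightarrow>
      d f g \<le> K * right_cayley_dist G (unit_nbhd G d 1) f g + K"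
    "\<And>f g. f \<in> carrier G \<Longrightarrow> g \<in> carrier G \<Longrightarrow>
      right_cayley_dist G (unit_nbhd G d 1) f g \<le> K * d f g + K"
    using right_cayley_dist_comparable[OF G d lsg S] by blast
  then have "quasi_isometry (carrier G) d (carrier G) (right_cayley_dist G (unit_nbhd G d 1)) (\<lambda>f. f)"
    by (rule quasi_isometry_identity) (auto simp: right_cayley_dist_nonneg right_cayley_dist_self G)
  then show ?thesis
    unfolding represents_quasi_isometry_class_def using S Metric_space_axioms by blast
qed

theorem represents_quasi_isometry_class_unique:
  assumes G: "group G" and d: "compatible_right_invariant_metric G T d"
    and lsg: "large_scale_geodesic G d" and d': "represents_quasi_isometry_class G T d'"
  shows "quasi_isometry (carrier G) d' (carrier G) d (\<lambda>f. f)"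
proof -
  interpret Metric_space "carrier G" d
    using d unfolding compatible_right_invariant_metric_def by blast
  obtain S where S: "open_symmetric_OB_generating G T S" and
    q: "quasi_isometry (carrier G) d' (carrier G) (right_cayley_dist G S) (\<lambda>f. f)"
    using d' unfolding represents_quasi_isometry_class_def by blast
  obtain K where b:
    "\<And>f g. f \<in> carrier G \<Longrightarrow> g \<in> carrier G \<Longrightarrow> d f g \<le> K * right_cayley_dist G S f g + K"
    "\<And>f g. f \<in> carrier G \<Longrightarrow> g \<in> carrier G \<Longrightarrow> right_cayley_dist G S f g \<le> K * d f g + K"
    using right_cayley_dist_comparable[OF G d lsg S] by blast
  have "quasi_isometry (carrier G) (right_cayley_dist G S) (carrier G) d (\<lambda>f. f)"
    using b(2,1) by (rule quasi_isometry_identity) (auto simp: right_cayley_dist_nonneg)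
  then show ?thesis by (rule quasi_isometry_compose[OF q _ Metric_space_axioms])
qed


section \<open>The circle as a quotient of the line\<close>

lemma circle_point_in_circle [simp]: "circle_point x \<in> circle"
  by (simp add: circle_point_def circle_def)

lemma circle_point_eq_iff: "circle_point x = circle_point y \<longleftrightarrow> (\<exists>n::int. x = y + of_int n)"
proof -
  have "circle_point x = circle_point y \<longleftrightarrow> (\<exists>n::int. 2 * pi * x = 2 * pi * y + 2 * n * pi)"
    unfolding circle_point_def exp_eq by (simp add: complex_eq_iff algebra_simps)
  also have "\<dots> \<longleftrightarrow> (\<exists>n::int. 2 * pi * x = 2 * pi * (y + n))"
    by (simp add: algebra_simps)
  finally show ?thesis by simp
qed

lemma continuous_on_circle_point: "continuous_on S circle_point"
  unfolding circle_point_def by (intro continuous_intros)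

lemma circle_point_Arg2pi: "z \<in> circle \<Longrightarrow> circle_point (Arg2pi z / (2 * pi)) = z"
  using Arg2pi_eq[of z] by (simp add: circle_point_def circle_def mult.commute)

lemma circle_point_surj:
  assumes "z \<in> circle"
  obtains x where "0 \<le> x" "x < 1" "circle_point x = z"
proof
  show "0 \<le> Arg2pi z / (2 * pi)" "Arg2pi z / (2 * pi) < 1"
    using Arg2pi_ge_0[of z] Arg2pi_lt_2pi[of z] by (auto simp: divide_less_eq)
  show "circle_point (Arg2pi z / (2 * pi)) = z" by (rule circle_point_Arg2pi[OF assms])
qed

lemma image_circle_point: "circle_point ` {0..1} = circle"
proof
  show "circle \<subseteq> circle_point ` {0..1}"
  proof
    fix z assume "z \<in> circle"
    then obtain x where "0 \<le> x" "x < 1" "circle_point x = z" by (rule circle_point_surj)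
    then show "z \<in> circle_point ` {0..1}" by (intro image_eqI[of _ _ x]) auto
  qed
qed auto

lemma dist_circle_point_le: "dist (circle_point x) (circle_point y) \<le> 2 * pi * \<bar>x - y\<bar>"
proof -
  let ?u = "\<i> * of_real (2 * pi * (x - y)) :: complex"
  have "circle_point x = circle_point y * exp ?u"
    unfolding circle_point_def by (simp add: exp_add[symmetric] algebra_simps)
  then have "circle_point x - circle_point y = circle_point y * (exp ?u - 1)"
    by (simp add: algebra_simps)
  then have "dist (circle_point x) (circle_point y) = norm (circle_point y) * norm (exp ?u - 1)"
    by (simp only: dist_norm norm_mult)
  also have "norm (circle_point y) = 1"
    by (simp add: circle_point_def)
  also have "1 * norm (exp ?u - 1) = 2 * \<bar>sin (pi * (x - y))\<bar>"
    by (simp only: dist_exp_i_1) simp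
  also have "\<dots> \<le> 2 * \<bar>pi * (x - y)\<bar>" using abs_sin_x_le_abs_x by simp
  finally show ?thesis by (simp add: abs_mult)
qed

text \<open>The circle carries the quotient topology of \<open>[0,1]\<close>, because \<^const>\<open>circle_point\<close> maps compact
  sets to closed sets.\<close>

lemma continuous_on_circleI:
  fixes h :: "complex \<Rightarrow> 'a::topological_space"
  assumes "continuous_on {0..1} (\<lambda>x. h (circle_point x))"
  shows "continuous_on circle h"
  unfolding continuous_on_closed_invariant
proof (intro allI impI)
  fix B :: "'a set" assume "closed B"
  let ?P = "{0..1} \<inter> (\<lambda>x. h (circle_point x)) -` B"
  have "closed ?P"
    by (rule continuous_closed_preimage[OF assms _ \<open>closed B\<close>]) simp
  then have "compact ({0..1} \<inter> ?P)" by (intro compact_Int_closed) auto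
  then have "closed (circle_point ` ({0..1} \<inter> ?P))"
    by (intro compact_imp_closed compact_continuous_image continuous_on_circle_point)
  moreover have "circle_point ` ({0..1} \<inter> ?P) \<inter> circle = h -` B \<inter> circle"
    using image_circle_point by fastforce
  ultimately show "\<exists>A. closed A \<and> A \<inter> circle = h -` B \<inter> circle" by blast
qed

text \<open>A function with equal values at the endpoints descends to the circle, where it is continuous;
  composing with \<^const>\<open>circle_point\<close> unrolls it along the line.\<close>

lemma periodic_extension:
  fixes p :: "real \<Rightarrow> 'a::topological_space"
  assumes "continuous_on {0..1} p" "p 0 = p 1"
  obtains u where "continuous_on UNIV u" "\<And>x. u (x + 1) = u x" "\<And>x. x \<in> {0..1} \<Longrightarrow> u x = p x"
proof
  \<comment> \<open>On \<open>[0,1]\<close> the normalised angle of \<open>circle_point x\<close> is \<open>x\<close> except at \<open>x = 1\<close>, where it is \<open>0\<close>.\<close>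
  define h where "h z = p (Arg2pi z / (2 * pi))" for z
  have h: "h (circle_point x) = p x" if x: "x \<in> {0..1}" for x
  proof -
    define y where "y = Arg2pi (circle_point x) / (2 * pi)"
    have y: "0 \<le> y" "y < 1"
      using Arg2pi_ge_0 Arg2pi_lt_2pi by (auto simp: y_def divide_less_eq)
    have "circle_point y = circle_point x" unfolding y_def by (rule circle_point_Arg2pi) simp
    then obtain n :: int where n: "y = x + of_int n" unfolding circle_point_eq_iff by blast
    then have "-1 \<le> real_of_int n" "real_of_int n < 1" using x y by auto
    then have "n = 0 \<or> n = -1" by linarith
    then have "y = x \<or> y = 0 \<and> x = 1" using x y n by auto
    then show ?thesis using assms(2) by (auto simp: h_def y_def[symmetric])
  qed
  have "continuous_on circle h"
    by (rule continuous_on_circleI, subst continuous_on_cong[OF refl h]) (use assms in auto)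
  then show "continuous_on UNIV (\<lambda>x. h (circle_point x))"
    by (intro continuous_on_compose2[OF _ continuous_on_circle_point]) auto
  show "h (circle_point (x + 1)) = h (circle_point x)" for x
    using circle_point_eq_iff[of "x + 1" x] by (metis of_int_1)
  show "\<And>x. x \<in> {0..1} \<Longrightarrow> h (circle_point x) = p x" by (rule h)
qed


section \<open>Diffeomorphisms of the circle and their lifts\<close>

text \<open>Unlike \<^const>\<open>is_lift\<close> this leaves \<open>F 0\<close> free, so that lifts compose and invert without
  renormalisation; \<open>F'\<close> is the derivative, whose positivity replaces any condition on the
  inverse.\<close>

definition diffeo_lift ::
  "(complex \<Rightarrow> complex) \<Rightarrow> (real \<Rightarrow> real) \<Rightarrow> (real \<Rightarrow> real) \<Rightarrow> bool"
  where
  "diffeo_lift f F F' \<longleftrightarrow>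
     (\<forall>x. F (x + 1) = F x + 1) \<and> (\<forall>x. (F has_real_derivative F' x) (at x)) \<and>
     continuous_on UNIV F' \<and> (\<forall>x. 0 < F' x) \<and>
     (\<forall>x. f (circle_point x) = circle_point (F x))"

lemma diffeo_liftD:
  assumes "diffeo_lift f F F'"
  shows "F (x + 1) = F x + 1" "(F has_real_derivative F' x) (at x)" "continuous_on UNIV F'"
    "0 < F' x" "f (circle_point x) = circle_point (F x)"
  using assms by (auto simp: diffeo_lift_def)

lemma degree_one_add_nat:
  fixes F :: "real \<Rightarrow> real"
  assumes "\<And>x. F (x + 1) = F x + 1"
  shows "F (x + real n) = F x + real n"
proof (induction n)
  case (Suc n)
  show ?case using assms[of "x + real n"] Suc by (simp add: algebra_simps)
qed simp

lemma degree_one_add_int: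
  fixes F :: "real \<Rightarrow> real"
  assumes "\<And>x. F (x + 1) = F x + 1"
  shows "F (x + of_int n) = F x + of_int n"
proof (cases "0 \<le> n")
  case True
  then show ?thesis using degree_one_add_nat[of F, OF assms, of x "nat n"] by simp
next
  case False
  then show ?thesis
    using degree_one_add_nat[of F, OF assms, of "x + of_int n" "nat (- n)"] by simp
qed

text \<open>The map of the circle with lift \<open>F\<close>, for \<open>F\<close> commuting with the integer translations.\<close>

definition circle_map :: "(real \<Rightarrow> real) \<Rightarrow> complex \<Rightarrow> complex"
  where "circle_map F = (\<lambda>z\<in>circle. circle_point (F (Arg2pi z / (2 * pi))))"

lemma circle_map_circle_point:
  assumes "\<And>x. F (x + 1) = F x + 1"
  shows "circle_map F (circle_point x) = circle_point (F x)"
proof -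
  obtain n :: int where "Arg2pi (circle_point x) / (2 * pi) = x + of_int n"
    using circle_point_Arg2pi[of "circle_point x"] by (auto simp: circle_point_eq_iff)
  then show ?thesis
    using degree_one_add_int[of F, OF assms] by (auto simp: circle_map_def circle_point_eq_iff)
qed

lemma diffeo_lift_circle_map:
  assumes "\<And>x. F (x + 1) = F x + 1" "\<And>x. (F has_real_derivative F' x) (at x)"
    "continuous_on UNIV F'" "\<And>x. 0 < F' x"
  shows "diffeo_lift (circle_map F) F F'"
  using assms circle_map_circle_point[of F, OF assms(1)] by (auto simp: diffeo_lift_def)

lemma diffeo_lift_periodic:
  assumes "diffeo_lift f F F'"
  shows "F' (x + 1) = F' x"
proof -
  note F = diffeo_liftD[OF assms]
  have "((\<lambda>x. F (x + 1)) has_real_derivative F' (x + 1)) (at x)"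
    using DERIV_shift F(2) by blast
  moreover have "((\<lambda>x. F x + 1) has_real_derivative F' x) (at x)"
    by (auto intro!: derivative_eq_intros F(2))
  moreover have "(\<lambda>x. F (x + 1)) = (\<lambda>x. F x + 1)" using F(1) by auto
  ultimately show ?thesis using DERIV_unique by metis
qed

lemma diffeo_lift_strict_mono:
  assumes "diffeo_lift f F F'"
  shows "strict_mono F"
  unfolding strict_mono_def
  using DERIV_pos_imp_increasing diffeo_liftD(2,4)[OF assms] by blast

lemma diffeo_lift_isCont: "diffeo_lift f F F' \<Longrightarrow> isCont F x"
  using DERIV_isCont diffeo_liftD(2) by blast

lemma degree_one_surj:
  fixes F :: "real \<Rightarrow> real"
  assumes F: "\<And>x. F (x + 1) = F x + 1" and cont: "\<And>x. isCont F x"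
  shows "\<exists>x. F x = y"
proof -
  define n where "n = \<lfloor>y - F 0\<rfloor>"
  have "F (of_int n) = F 0 + of_int n" "F (of_int n + 1) = F 0 + of_int n + 1"
    using degree_one_add_int[of F 0 n, OF F] F by auto
  moreover have "of_int n \<le> y - F 0" "y - F 0 < of_int n + 1" unfolding n_def by linarith+
  ultimately have "F (of_int n) \<le> y" "y \<le> F (of_int n + 1)" by linarith+
  then show ?thesis
    using IVT[of F "of_int n" y "of_int n + 1"] cont by auto
qed

text \<open>\<^const>\<open>diff1_plus\<close> speaks of the lift of the inverse map without asserting that one exists; the
  continuous inverse of the lift provides it.\<close>

lemma degree_one_inverse:
  fixes F :: "real \<Rightarrow> real"
  assumes F: "\<And>x. F (x + 1) = F x + 1" and cont: "\<And>x. isCont F x" and mono: "strict_mono F"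
  obtains G where "\<And>x. G (F x) = x" "\<And>y. F (G y) = y" "\<And>y. G (y + 1) = G y + 1" "\<And>y. isCont G y"
proof -
  define G where "G = inv_into UNIV F"
  have inj: "inj F" using mono by (rule strict_mono_imp_inj_on)
  have GF: "G (F x) = x" for x unfolding G_def by (rule inv_f_f[OF inj])
  have FG: "F (G y) = y" for y
    unfolding G_def using degree_one_surj[of F, OF F cont] by (metis f_inv_into_f rangeI)
  have "isCont G y" for y
  proof -
    have "isCont G (F (G y))"
      by (rule isCont_inverse_function[of 1]) (auto simp: GF cont)
    then show ?thesis by (simp add: FG)
  qed
  moreover have "G (y + 1) = G y + 1" for y
  proof -
    have "F (G y + 1) = y + 1" by (simp add: F FG)
    then show ?thesis using GF by metis
  qed
  ultimately show thesis using that GF FG by blast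
qed

lemma diffeo_lift_bij_betw:
  assumes f: "diffeo_lift f F F'"
  shows "bij_betw f circle circle"
  unfolding bij_betw_def
proof
  show "inj_on f circle"
  proof (rule inj_onI)
    fix z w assume zw: "z \<in> circle" "w \<in> circle" "f z = f w"
    then obtain x y where xy: "z = circle_point x" "w = circle_point y"
      by (metis circle_point_surj)
    then obtain n :: int where "F x = F y + of_int n"
      using zw(3) diffeo_liftD(5)[OF f] by (auto simp: circle_point_eq_iff)
    then have "F x = F (y + of_int n)"
      using degree_one_add_int diffeo_liftD(1)[OF f] by simp
    then have "x = y + of_int n"
      using strict_mono_eq[OF diffeo_lift_strict_mono[OF f]] by simp
    then show "z = w" unfolding xy circle_point_eq_iff by blast
  qed
  show "f ` circle = circle"
  proof
    show "f ` circle \<subseteq> circle"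
      unfolding image_circle_point[symmetric]
      using diffeo_liftD(5)[OF f] image_circle_point circle_point_in_circle by fastforce
    show "circle \<subseteq> f ` circle"
    proof
      fix w assume "w \<in> circle"
      then obtain y where y: "w = circle_point y" by (metis circle_point_surj)
      then obtain x where "F x = y" using degree_one_surj[of F, OF diffeo_liftD(1)[OF f] diffeo_lift_isCont[OF f]] by blast
      then show "w \<in> f ` circle"
        using y diffeo_liftD(5)[OF f] circle_point_in_circle by (metis imageI)
    qed
  qed
qed

lemma diffeo_lift_id: "diffeo_lift (\<lambda>z\<in>circle. z) (\<lambda>x. x) (\<lambda>x. 1)"
  by (simp add: diffeo_lift_def)

lemma diffeo_lift_compose:
  assumes f: "diffeo_lift f F F'" and g: "diffeo_lift g G G'"
  shows "diffeo_lift (compose circle f g) (\<lambda>x. F (G x)) (\<lambda>x. F' (G x) * G' x)"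
  unfolding diffeo_lift_def
proof (intro conjI allI)
  note F = diffeo_liftD[OF f] and G = diffeo_liftD[OF g]
  fix x
  show "F (G (x + 1)) = F (G x) + 1" by (simp add: F G)
  show "((\<lambda>x. F (G x)) has_real_derivative F' (G x) * G' x) (at x)"
    by (rule DERIV_chain2[OF F(2) G(2)])
  have "continuous_on UNIV G"
    using diffeo_lift_isCont[OF g] by (simp add: continuous_at_imp_continuous_on)
  then show "continuous_on UNIV (\<lambda>x. F' (G x) * G' x)"
    by (intro continuous_on_mult continuous_on_compose2[OF F(3)] G(3)) auto
  show "0 < F' (G x) * G' x" by (simp add: F G)
  show "compose circle f g (circle_point x) = circle_point (F (G x))"
    by (simp add: compose_def F G)
qed

lemma diffeo_lift_inverse:
  assumes f: "diffeo_lift f F F'"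
  obtains G G' where "diffeo_lift (\<lambda>z\<in>circle. inv_into circle f z) G G'"
proof -
  note F = diffeo_liftD[OF f]
  obtain G where GF: "\<And>x. G (F x) = x" and FG: "\<And>y. F (G y) = y"
    and G: "\<And>y. G (y + 1) = G y + 1" and cont: "\<And>y. isCont G y"
    using degree_one_inverse[of F, OF F(1) diffeo_lift_isCont[OF f] diffeo_lift_strict_mono[OF f]] by metis
  have "diffeo_lift (\<lambda>z\<in>circle. inv_into circle f z) G (\<lambda>y. inverse (F' (G y)))"
    unfolding diffeo_lift_def
  proof (intro conjI allI)
    fix x
    show "G (x + 1) = G x + 1" by (rule G)
    show "(G has_real_derivative inverse (F' (G x))) (at x)"
      by (rule DERIV_inverse_function[of F, where a = "x - 1" and b = "x + 1"])
        (use F(2,4)[of "G x"] FG cont in auto)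
    show "continuous_on UNIV (\<lambda>y. inverse (F' (G y)))"
      using F(4) cont
      by (intro continuous_on_inverse continuous_on_compose2[OF F(3)])
        (auto simp: continuous_at_imp_continuous_on less_imp_neq[THEN not_sym])
    show "0 < inverse (F' (G x))" by (simp add: F)
    have "f (circle_point (G x)) = circle_point x" by (simp add: F FG)
    then have "inv_into circle f (circle_point x) = circle_point (G x)"
      using diffeo_lift_bij_betw[OF f] circle_point_in_circle
      unfolding bij_betw_def by (metis inv_into_f_f)
    then show "(\<lambda>z\<in>circle. inv_into circle f z) (circle_point x) = circle_point (G x)" by simp
  qed
  then show thesis by (rule that)
qed

lemma lift_eq: "is_lift f F \<Longrightarrow> lift f = F"
  unfolding lift_def using is_lift_unique by blast

lemma diffeo_lift_is_lift:
  assumes f: "diffeo_lift f F F'"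
  shows "is_lift f (\<lambda>x. F x - of_int \<lfloor>F 0\<rfloor>)"
proof -
  have "continuous_on UNIV F"
    using diffeo_lift_isCont[OF f] by (simp add: continuous_at_imp_continuous_on)
  then have "continuous_on UNIV (\<lambda>x. F x - of_int \<lfloor>F 0\<rfloor>)" by (intro continuous_intros)
  moreover have "circle_point (F x) = circle_point (F x - of_int \<lfloor>F 0\<rfloor>)" for x
    unfolding circle_point_eq_iff by (rule exI[of _ "\<lfloor>F 0\<rfloor>"]) simp
  moreover have "F 0 - of_int \<lfloor>F 0\<rfloor> < 1" by linarith
  ultimately show ?thesis
    unfolding is_lift_def using diffeo_liftD[OF f] by auto
qed

lemma circle_deriv_eq:
  assumes f: "diffeo_lift f F F'"
  shows "circle_deriv f = F'"
proof
  fix x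
  have "((\<lambda>x. F x - of_int \<lfloor>F 0\<rfloor>) has_real_derivative F' x) (at x)"
    by (auto intro!: derivative_eq_intros diffeo_liftD(2)[OF f])
  then show "circle_deriv f x = F' x"
    unfolding circle_deriv_def lift_eq[OF diffeo_lift_is_lift[OF f]] by (rule DERIV_imp_deriv)
qed

lemma diffeo_lift_lift_C1:
  assumes f: "diffeo_lift f F F'"
  shows "lift f C1_differentiable_on UNIV"
proof -
  have "((\<lambda>x. F x - of_int \<lfloor>F 0\<rfloor>) has_real_derivative F' x) (at x)" for x
    by (auto intro!: derivative_eq_intros diffeo_liftD(2)[OF f])
  then show ?thesis
    unfolding lift_eq[OF diffeo_lift_is_lift[OF f]] C1_differentiable_on_def
    using diffeo_liftD(3)[OF f] by (auto simp: has_real_derivative_iff_has_vector_derivative)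
qed

lemma diffeo_lift_homeo_plus:
  assumes f: "diffeo_lift f F F'" and ext: "f \<in> extensional circle"
  shows "f \<in> homeo_plus"
proof -
  have "continuous_on {0..1} F"
    using diffeo_lift_isCont[OF f] by (simp add: continuous_at_imp_continuous_on)
  then have "continuous_on {0..1} (\<lambda>x. circle_point (F x))"
    by (rule continuous_on_compose2[OF continuous_on_circle_point[of UNIV]]) simp
  then have "continuous_on circle f"
    by (intro continuous_on_circleI) (simp add: diffeo_liftD(5)[OF f])
  moreover have "compact circle" by (simp add: circle_def)
  ultimately have "\<exists>g. homeomorphism circle circle f g"
    using diffeo_lift_bij_betw[OF f] unfolding bij_betw_def by (intro homeomorphism_compact) auto
  moreover have "strict_mono (\<lambda>x. F x - of_int \<lfloor>F 0\<rfloor>)"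
    using diffeo_lift_strict_mono[OF f] by (simp add: strict_mono_def)
  ultimately show ?thesis
    unfolding homeo_plus_def using ext diffeo_lift_is_lift[OF f] by blast
qed

text \<open>From left to right, the derivative of the lift cannot vanish, since the chain rule applies to its
  composition with the differentiable lift of the inverse.  From right to left, the inverse function
  theorem makes the inverse lift differentiable.\<close>

lemma diff1_plus_iff:
  "f \<in> diff1_plus \<longleftrightarrow> f \<in> extensional circle \<and> (\<exists>F F'. diffeo_lift f F F')"
proof
  assume "f \<in> extensional circle \<and> (\<exists>F F'. diffeo_lift f F F')"
  then obtain F F' where ext: "f \<in> extensional circle" and f: "diffeo_lift f F F'" by blast
  obtain G G' where g: "diffeo_lift (\<lambda>z\<in>circle. inv_into circle f z) G G'"
    using diffeo_lift_inverse[OF f] .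
  have "f \<in> Bij circle" using ext diffeo_lift_bij_betw[OF f] by (simp add: Bij_def)
  then have "lift (inv\<^bsub>BijGroup circle\<^esub> f) C1_differentiable_on UNIV"
    using diffeo_lift_lift_C1[OF g] by (simp add: inv_BijGroup)
  then show "f \<in> diff1_plus"
    unfolding diff1_plus_def
    using diffeo_lift_homeo_plus[OF f ext] diffeo_lift_lift_C1[OF f] by blast
next
  assume f: "f \<in> diff1_plus"
  define g where "g = inv\<^bsub>BijGroup circle\<^esub> f"
  define F where "F = lift f"
  have ext: "f \<in> extensional circle" using f by (simp add: diff1_plus_def homeo_plus_def)
  obtain F0 where F0: "is_lift f F0" "strict_mono F0"
    using f unfolding diff1_plus_def homeo_plus_def by blast
  have "F0 = F" using lift_eq[OF F0(1)] by (simp add: F_def)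
  then have F: "\<And>x. F (x + 1) = F x + 1" "\<And>x. isCont F x" "strict_mono F"
    "\<And>x. f (circle_point x) = circle_point (F x)"
    using F0 by (auto simp: is_lift_def continuous_on_eq_continuous_at)
  obtain F' where F': "\<And>x. (F has_real_derivative F' x) (at x)" "continuous_on UNIV F'"
    using f unfolding diff1_plus_def F_def C1_differentiable_on_def
    by (auto simp: has_real_derivative_iff_has_vector_derivative)
  have bij: "bij_betw f circle circle"
  proof -
    obtain h where "homeomorphism circle circle f h"
      using f unfolding diff1_plus_def homeo_plus_def by blast
    then show ?thesis unfolding homeomorphism_def bij_betw_def by (metis inj_on_inverseI)
  qed
  have g: "g = (\<lambda>z\<in>circle. inv_into circle f z)"
    unfolding g_def using ext bij by (intro inv_BijGroup) (simp add: Bij_def)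
  obtain G where GF: "\<And>x. G (F x) = x" and FG: "\<And>y. F (G y) = y"
    and G: "\<And>y. G (y + 1) = G y + 1" "\<And>y. isCont G y"
    using degree_one_inverse[of F, OF F(1-3)] by metis
  define c :: real where "c = of_int \<lfloor>G 0\<rfloor>"
  have "is_lift g (\<lambda>y. G y - c)"
    unfolding is_lift_def
  proof (intro conjI allI)
    show "continuous_on UNIV (\<lambda>y. G y - c)"
      using G(2) by (intro continuous_intros) (simp add: continuous_at_imp_continuous_on)
    show "0 \<le> G 0 - c" "G 0 - c < 1" unfolding c_def by linarith+
    fix y
    show "G (y + 1) - c = G y - c + 1" by (simp add: G)
    have "f (circle_point (G y)) = circle_point y" by (simp add: F FG)
    then have "inv_into circle f (circle_point y) = circle_point (G y)"
      using bij circle_point_in_circle unfolding bij_betw_def by (metis inv_into_f_f)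
    moreover have "circle_point (G y) = circle_point (G y - c)"
      unfolding circle_point_eq_iff c_def by (rule exI[of _ "\<lfloor>G 0\<rfloor>"]) simp
    ultimately show "g (circle_point y) = circle_point (G y - c)" by (simp add: g)
  qed
  then have "lift g = (\<lambda>y. G y - c)" by (rule lift_eq)
  then have "(\<lambda>y. G y - c) C1_differentiable_on UNIV"
    using f by (simp add: diff1_plus_def g_def)
  then obtain G' where G': "\<And>y. ((\<lambda>y. G y - c) has_real_derivative G' y) (at y)"
    unfolding C1_differentiable_on_def
    by (auto simp: has_real_derivative_iff_has_vector_derivative)
  have "0 < F' x" for x
  proof -
    have "((\<lambda>x. G (F x) - c) has_real_derivative G' (F x) * F' x) (at x)"
      by (rule DERIV_chain2[OF G' F'(1)])
    moreover have "((\<lambda>x. G (F x) - c) has_real_derivative 1) (at x)"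
      unfolding GF by (auto intro!: derivative_eq_intros)
    ultimately have "G' (F x) * F' x = 1" by (rule DERIV_unique)
    then have "F' x \<noteq> 0" by auto
    moreover have "\<not> F' x < 0"
    proof
      assume "F' x < 0"
      then obtain d where "0 < d" "\<And>h. 0 < h \<Longrightarrow> h < d \<Longrightarrow> F (x + h) < F x"
        using DERIV_neg_dec_right[OF F'(1)] by blast
      then have "F (x + d / 2) < F x" by simp
      then show False using strict_monoD[OF F(3), of x "x + d / 2"] \<open>0 < d\<close> by simp
    qed
    ultimately show ?thesis by linarith
  qed
  then have "diffeo_lift f F F'"
    unfolding diffeo_lift_def using F F' by simp
  then show "f \<in> extensional circle \<and> (\<exists>F F'. diffeo_lift f F F')" using ext by blast
qed


section \<open>The group of diffeomorphisms\<close>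

lemma subgroup_diff1_plus: "subgroup diff1_plus (BijGroup circle)"
proof (rule subgroup.intro)
  have Bij: "f \<in> Bij circle" if "f \<in> diff1_plus" for f
    using that diffeo_lift_bij_betw by (auto simp: diff1_plus_iff Bij_def)
  then show "diff1_plus \<subseteq> carrier (BijGroup circle)" by (auto simp: BijGroup_def)
  show "\<one>\<^bsub>BijGroup circle\<^esub> \<in> diff1_plus"
    using diffeo_lift_id by (auto simp: BijGroup_def diff1_plus_iff)
  show "f \<otimes>\<^bsub>BijGroup circle\<^esub> g \<in> diff1_plus" if fg: "f \<in> diff1_plus" "g \<in> diff1_plus" for f g
  proof -
    obtain F F' G G' where "diffeo_lift f F F'" "diffeo_lift g G G'"
      using fg by (metis diff1_plus_iff)
    then have "compose circle f g \<in> diff1_plus"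
      using diffeo_lift_compose by (fastforce simp: diff1_plus_iff)
    then show ?thesis using fg Bij by (simp add: BijGroup_def)
  qed
  show "inv\<^bsub>BijGroup circle\<^esub> f \<in> diff1_plus" if f: "f \<in> diff1_plus" for f
  proof -
    obtain F F' where "diffeo_lift f F F'" using f by (auto simp: diff1_plus_iff)
    then obtain G G' where "diffeo_lift (\<lambda>z\<in>circle. inv_into circle f z) G G'"
      by (rule diffeo_lift_inverse)
    then have "(\<lambda>z\<in>circle. inv_into circle f z) \<in> diff1_plus" by (auto simp: diff1_plus_iff)
    then show ?thesis using f Bij by (simp add: inv_BijGroup)
  qed
qed

lemma group_Diff1_plus: "group Diff1_plus"
  unfolding Diff1_plus_def by (rule subgroup.subgroup_is_group[OF subgroup_diff1_plus group_BijGroup])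

lemma carrier_Diff1_plus [simp]: "carrier Diff1_plus = diff1_plus"
  by (simp add: Diff1_plus_def)

lemma one_Diff1_plus: "\<one>\<^bsub>Diff1_plus\<^esub> = (\<lambda>z\<in>circle. z)"
  by (simp add: Diff1_plus_def BijGroup_def)

lemma mult_Diff1_plus:
  assumes "f \<in> diff1_plus" "g \<in> diff1_plus"
  shows "f \<otimes>\<^bsub>Diff1_plus\<^esub> g = compose circle f g"
proof -
  have "f \<in> Bij circle" "g \<in> Bij circle"
    using subgroup.subset[OF subgroup_diff1_plus] assms by (auto simp: BijGroup_def)
  then show ?thesis by (simp add: Diff1_plus_def BijGroup_def)
qed


section \<open>The logarithmic derivative\<close>

lemma diff1_plus_lift:
  assumes "f \<in> diff1_plus"
  obtains F where "diffeo_lift f F (circle_deriv f)"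
  using assms circle_deriv_eq by (metis diff1_plus_iff)

lemma diffeo_lift_shift:
  assumes f: "diffeo_lift f F F'"
  shows "diffeo_lift f (\<lambda>x. F x - of_int n) F'"
  unfolding diffeo_lift_def
proof (intro conjI allI)
  note F = diffeo_liftD[OF f]
  fix x
  show "F (x + 1) - of_int n = F x - of_int n + 1" by (simp add: F)
  show "((\<lambda>x. F x - of_int n) has_real_derivative F' x) (at x)"
    by (auto intro!: derivative_eq_intros F(2))
  show "continuous_on UNIV F'" "0 < F' x" by (rule F)+
  show "f (circle_point x) = circle_point (F x - of_int n)"
    unfolding F circle_point_eq_iff by (rule exI[of _ n]) simp
qed

definition log_deriv :: "(complex \<Rightarrow> complex) \<Rightarrow> real \<Rightarrow> real"
  where "log_deriv f x = ln (circle_deriv f x)"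

lemma circle_deriv_pos: "f \<in> diff1_plus \<Longrightarrow> 0 < circle_deriv f x"
  using diff1_plus_lift diffeo_liftD(4) by metis

lemma continuous_on_circle_deriv: "f \<in> diff1_plus \<Longrightarrow> continuous_on S (circle_deriv f)"
  using diff1_plus_lift diffeo_liftD(3) continuous_on_subset by (metis subset_UNIV)

lemma continuous_on_log_deriv: "f \<in> diff1_plus \<Longrightarrow> continuous_on S (log_deriv f)"
  unfolding log_deriv_def[abs_def]
  using circle_deriv_pos by (intro continuous_on_ln continuous_on_circle_deriv) (auto simp: less_imp_neq[THEN not_sym])

text \<open>A 1-periodic \<open>u\<close> becomes a map commuting with integer translations once \<open>x\<close> is added.\<close>

lemma periodic_frac:
  fixes u :: "real \<Rightarrow> real"
  assumes "\<And>x. u (x + 1) = u x"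
  shows "u (frac x) = u x"
proof -
  have "u (x + of_int (- \<lfloor>x\<rfloor>)) + (x + of_int (- \<lfloor>x\<rfloor>)) = u x + x + of_int (- \<lfloor>x\<rfloor>)"
    by (rule degree_one_add_int[of "\<lambda>x. u x + x"]) (simp add: assms)
  then show ?thesis by (simp add: frac_def)
qed

lemma circle_deriv_periodic: "f \<in> diff1_plus \<Longrightarrow> circle_deriv f (x + 1) = circle_deriv f x"
  using diff1_plus_lift diffeo_lift_periodic by metis

lemma circle_deriv_frac: "f \<in> diff1_plus \<Longrightarrow> circle_deriv f (frac x) = circle_deriv f x"
  by (rule periodic_frac[of "circle_deriv f"]) (rule circle_deriv_periodic)

lemma log_deriv_frac: "f \<in> diff1_plus \<Longrightarrow> log_deriv f (frac x) = log_deriv f x"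
  by (simp add: log_deriv_def circle_deriv_frac)

lemma frac_mem [simp]: "frac (x::real) \<in> {0..1}"
  using frac_lt_1[of x] by simp

lemma log_deriv_bounded:
  assumes "f \<in> diff1_plus"
  obtains B where "\<And>x. \<bar>log_deriv f x\<bar> \<le> B"
proof -
  have "bounded (log_deriv f ` {0..1})"
    using assms by (intro compact_imp_bounded compact_continuous_image continuous_on_log_deriv) auto
  then obtain B where "\<forall>x\<in>{0..1}. \<bar>log_deriv f x\<bar> \<le> B"
    unfolding bounded_iff by auto
  then show thesis using that[of B] log_deriv_frac[OF assms] frac_mem by metis
qed

lemma log_deriv_one: "log_deriv (\<lambda>z\<in>circle. z) x = 0"
  by (simp add: log_deriv_def circle_deriv_eq[OF diffeo_lift_id])

text \<open>The chain rule.  Right translation thus reparametrises the logarithmic derivative and adds a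
  function depending on the right factor only, which cancels in differences.\<close>

lemma log_deriv_compose:
  assumes f: "f \<in> diff1_plus" and g: "diffeo_lift g G G'"
  shows "log_deriv (compose circle f g) x = log_deriv f (G x) + ln (G' x)"
proof -
  obtain F where F: "diffeo_lift f F (circle_deriv f)" using diff1_plus_lift[OF f] .
  show ?thesis
    using circle_deriv_eq[OF diffeo_lift_compose[OF F g]] circle_deriv_pos[OF f, of "G x"]
      diffeo_liftD(4)[OF g, of x]
    by (simp add: log_deriv_def ln_mult)
qed

text \<open>Both lifts increase by 1 over a period, so by Rolle's theorem the derivatives agree at some
  point.  The difference of the logarithmic derivatives vanishes there, and its oscillation bounds its
  absolute value: normalising by an additive constant, as \<^const>\<open>Phi1\<close> does, loses nothing on the large
  scale.\<close>

lemma log_deriv_diff_le_oscillation: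
  assumes f: "f \<in> diff1_plus" and g: "g \<in> diff1_plus"
    and osc: "\<And>x y. \<bar>(log_deriv f x - log_deriv g x) - (log_deriv f y - log_deriv g y)\<bar> \<le> \<delta>"
  shows "\<bar>log_deriv f x - log_deriv g x\<bar> \<le> \<delta>"
proof -
  obtain F G where F: "diffeo_lift f F (circle_deriv f)" and G: "diffeo_lift g G (circle_deriv g)"
    using diff1_plus_lift f g by metis
  have "F 1 = F 0 + 1" "G 1 = G 0 + 1"
    using diffeo_liftD(1)[OF F, of 0] diffeo_liftD(1)[OF G, of 0] by auto
  moreover have D: "((\<lambda>x. F x - G x) has_real_derivative circle_deriv f x - circle_deriv g x) (at x)" for x
    by (intro DERIV_diff diffeo_liftD(2)[OF F] diffeo_liftD(2)[OF G])
  ultimately have "\<exists>y. DERIV (\<lambda>x. F x - G x) y :> 0"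
    using Rolle[of 0 1 "\<lambda>x. F x - G x"] DERIV_isCont[OF D]
    by (force simp: continuous_at_imp_continuous_on real_differentiable_def)
  then obtain y where "DERIV (\<lambda>x. F x - G x) y :> 0" by blast
  then have "circle_deriv f y = circle_deriv g y" using DERIV_unique[OF D] by fastforce
  then show ?thesis using osc[of x y] by (simp add: log_deriv_def)
qed

text \<open>The function \<open>C G - F\<close> is nondecreasing, and \<open>G\<close> grows by at most 1 on \<open>[0,1]\<close>.\<close>

lemma diffeo_lift_growth_le:
  assumes f: "diffeo_lift f F F'" and g: "diffeo_lift g G G'"
    and le: "\<And>x. F' x \<le> C * G' x" and C: "1 \<le> C" and x: "0 \<le> x" "x \<le> 1"
  shows "(F x - F 0) - (G x - G 0) \<le> C - 1"
proof -
  define H where "H x = C * G x - F x" for x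
  have "H 0 \<le> H x"
  proof (rule DERIV_nonneg_imp_nondecreasing[OF x(1)])
    fix t
    have "(H has_real_derivative C * G' t - F' t) (at t)"
      unfolding H_def
      by (auto intro!: derivative_eq_intros diffeo_liftD(2)[OF f] diffeo_liftD(2)[OF g])
    then show "\<exists>y. DERIV H t :> y \<and> 0 \<le> y" using le[of t] by auto
  qed
  then have "F x - F 0 \<le> C * (G x - G 0)" by (simp add: H_def algebra_simps)
  moreover have "G x \<le> G 1"
    using diffeo_lift_strict_mono[OF g] x(2) by (simp add: strict_mono_less_eq)
  then have "G x - G 0 \<le> 1" using diffeo_liftD(1)[OF g, of 0] by simp
  then have "(C - 1) * (G x - G 0) \<le> (C - 1) * 1" using C by (intro mult_left_mono) auto
  ultimately show ?thesis by (simp add: algebra_simps)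
qed

text \<open>Integrate \<open>exp u\<close> and divide by its integral \<open>W\<close> over a period, so that the primitive increases by 1
  over a period; the constant \<open>Z\<close> is \<open>ln W\<close>.\<close>

lemma diff1_plus_with_log_deriv:
  assumes u: "continuous_on UNIV u" "\<And>x. u (x + 1) = u x"
  obtains f F Z where "f \<in> diff1_plus" "diffeo_lift f F (circle_deriv f)" "F 0 = a"
    "\<And>x. log_deriv f x = u x - Z"
proof -
  have "\<exists>E. \<forall>x::real. -\<infinity> < ereal x \<longrightarrow> ereal x < \<infinity> \<longrightarrow>
      (E has_vector_derivative exp (u x)) (at x)"
    using u(1) by (intro einterval_antiderivative) (auto simp: continuous_on_eq_continuous_at intro!: continuous_intros)
  then obtain E where E: "\<And>x. (E has_real_derivative exp (u x)) (at x)"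
    by (auto simp: has_real_derivative_iff_has_vector_derivative)
  have "((\<lambda>x. E (x + 1) - E x) has_real_derivative 0) (at x)" for x
  proof -
    have "((\<lambda>x. E (x + 1)) has_real_derivative exp (u (x + 1))) (at x)"
      using DERIV_shift E by blast
    then show ?thesis using DERIV_diff[OF _ E[of x]] u(2)[of x] by fastforce
  qed
  then have "\<exists>W. \<forall>x. E (x + 1) - E x = W"
    using DERIV_isconst_all[of "\<lambda>x. E (x + 1) - E x"] by blast
  then obtain W where W: "\<And>x. E (x + 1) - E x = W" by blast
  have "E 0 < E 1"
  proof (rule DERIV_pos_imp_increasing[of 0 1 E])
    show "\<exists>y. DERIV E x :> y \<and> 0 < y" for x using E exp_gt_zero by blast
  qed simp
  then have Wpos: "0 < W" using W[of 0] by simp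
  define F where "F x = (E x - E 0) / W + a" for x
  have dl: "diffeo_lift (circle_map F) F (\<lambda>x. exp (u x) / W)"
  proof (rule diffeo_lift_circle_map)
    fix x
    have "E (x + 1) = E x + W" using W[of x] by simp
    then show "F (x + 1) = F x + 1" using Wpos by (simp add: F_def field_simps)
    show "(F has_real_derivative exp (u x) / W) (at x)"
      unfolding F_def using Wpos by (auto intro!: derivative_eq_intros E)
    show "continuous_on UNIV (\<lambda>x. exp (u x) / W)" by (intro continuous_intros) (use u Wpos in auto)
  qed (use Wpos in auto)
  show thesis
  proof (rule that[of "circle_map F" F "ln W"])
    show "circle_map F \<in> diff1_plus"
      using dl unfolding diff1_plus_iff by (auto simp: circle_map_def)
    show "diffeo_lift (circle_map F) F (circle_deriv (circle_map F))"
      using dl by (simp add: circle_deriv_eq[OF dl])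
    show "F 0 = a" by (simp add: F_def)
    show "log_deriv (circle_map F) x = u x - ln W" for x
      using Wpos by (simp add: log_deriv_def circle_deriv_eq[OF dl] ln_div)
  qed
qed


section \<open>A right-invariant metric\<close>

definition circle_sup_dist :: "(complex \<Rightarrow> complex) \<Rightarrow> (complex \<Rightarrow> complex) \<Rightarrow> real"
  where "circle_sup_dist f g = (SUP z\<in>circle. dist (f z) (g z))"

definition log_deriv_dist :: "(complex \<Rightarrow> complex) \<Rightarrow> (complex \<Rightarrow> complex) \<Rightarrow> real"
  where "log_deriv_dist f g = (SUP x. \<bar>log_deriv f x - log_deriv g x\<bar>)"

text \<open>The metric \<^const>\<open>rho1\<close> is not right-invariant, because right translation by \<open>h\<close> multiplies
  derivatives by \<open>h'\<close>.  Passing to logarithms turns the factor into a summand, which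
  cancels.  The value \<open>0\<close> off \<^const>\<open>diff1_plus\<close> makes the function symmetric and nonnegative on the whole
  type.\<close>

definition log_rho :: "(complex \<Rightarrow> complex) \<Rightarrow> (complex \<Rightarrow> complex) \<Rightarrow> real"
  where
  "log_rho f g =
     (if f \<in> diff1_plus \<and> g \<in> diff1_plus then circle_sup_dist f g + log_deriv_dist f g else 0)"

lemma diff1_plus_in_circle: "f \<in> diff1_plus \<Longrightarrow> z \<in> circle \<Longrightarrow> f z \<in> circle"
  using diffeo_lift_bij_betw unfolding diff1_plus_iff bij_betw_def by blast

lemma diff1_plus_dist_le_2:
  assumes "f \<in> diff1_plus" "g \<in> diff1_plus" "z \<in> circle"
  shows "dist (f z) (g z) \<le> 2"
proof -
  have "norm (f z) = 1" "norm (g z) = 1"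
    using diff1_plus_in_circle[of _ z] assms by (simp_all add: circle_def)
  then show ?thesis using norm_triangle_ineq4[of "f z" "g z"] by (simp add: dist_norm)
qed

lemma circle_sup_dist_upper:
  assumes "f \<in> diff1_plus" "g \<in> diff1_plus" "z \<in> circle"
  shows "dist (f z) (g z) \<le> circle_sup_dist f g"
  unfolding circle_sup_dist_def
  using assms by (intro cSUP_upper bdd_aboveI2[of _ _ 2] diff1_plus_dist_le_2)

lemma circle_sup_dist_least:
  assumes "\<And>z. z \<in> circle \<Longrightarrow> dist (f z) (g z) \<le> a"
  shows "circle_sup_dist f g \<le> a"
  unfolding circle_sup_dist_def
  by (rule cSUP_least) (use assms in \<open>auto simp: circle_def\<close>)

lemma log_deriv_dist_upper:
  assumes "f \<in> diff1_plus" "g \<in> diff1_plus"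
  shows "\<bar>log_deriv f x - log_deriv g x\<bar> \<le> log_deriv_dist f g"
proof -
  obtain B C where "\<And>x. \<bar>log_deriv f x\<bar> \<le> B" "\<And>x. \<bar>log_deriv g x\<bar> \<le> C"
    using log_deriv_bounded assms by metis
  then have "\<bar>log_deriv f x - log_deriv g x\<bar> \<le> B + C" for x
    using abs_triangle_ineq4[of "log_deriv f x" "log_deriv g x"] by (smt (verit))
  then show ?thesis
    unfolding log_deriv_dist_def by (intro cSUP_upper bdd_aboveI2[of _ _ "B + C"]) auto
qed

lemma log_deriv_dist_least:
  assumes "\<And>x. \<bar>log_deriv f x - log_deriv g x\<bar> \<le> b"
  shows "log_deriv_dist f g \<le> b"
  unfolding log_deriv_dist_def by (rule cSUP_least) (use assms in auto)

lemma circle_sup_dist_nonneg: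
  assumes "f \<in> diff1_plus" "g \<in> diff1_plus"
  shows "0 \<le> circle_sup_dist f g"
  using circle_sup_dist_upper[OF assms circle_point_in_circle] zero_le_dist order_trans by blast

lemma log_deriv_dist_nonneg:
  assumes "f \<in> diff1_plus" "g \<in> diff1_plus"
  shows "0 \<le> log_deriv_dist f g"
  using log_deriv_dist_upper[OF assms] abs_ge_zero order_trans by blast

lemma diff1_plus_eqI:
  assumes "f \<in> diff1_plus" "g \<in> diff1_plus" "circle_sup_dist f g \<le> 0"
  shows "f = g"
proof (rule extensionalityI[of f circle g])
  show "f z = g z" if "z \<in> circle" for z
    using order_trans[OF circle_sup_dist_upper[OF assms(1,2) that] assms(3)] by simp
qed (use assms in \<open>auto simp: diff1_plus_iff\<close>)

lemma Metric_space_log_rho: "Metric_space diff1_plus log_rho"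
proof
  show "0 \<le> log_rho f g" for f g
    by (simp add: log_rho_def circle_sup_dist_nonneg log_deriv_dist_nonneg)
  show "log_rho f g = log_rho g f" for f g
    by (simp add: log_rho_def circle_sup_dist_def log_deriv_dist_def dist_commute abs_minus_commute)
  show "log_rho f g = 0 \<longleftrightarrow> f = g" if f: "f \<in> diff1_plus" and g: "g \<in> diff1_plus" for f g
  proof
    assume "log_rho f g = 0"
    then have "circle_sup_dist f g \<le> 0"
      using log_deriv_dist_nonneg[OF f g] by (simp add: log_rho_def f g)
    then show "f = g" by (rule diff1_plus_eqI[OF f g])
  next
    assume "f = g"
    moreover have "circle \<noteq> {}" by (simp add: circle_def)
    ultimately show "log_rho f g = 0"
      by (simp add: log_rho_def circle_sup_dist_def log_deriv_dist_def)
  qed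
  show "log_rho f h \<le> log_rho f g + log_rho g h"
    if f: "f \<in> diff1_plus" and g: "g \<in> diff1_plus" and h: "h \<in> diff1_plus" for f g h
  proof -
    have "circle_sup_dist f h \<le> circle_sup_dist f g + circle_sup_dist g h"
    proof (rule circle_sup_dist_least)
      fix z assume z: "z \<in> circle"
      show "dist (f z) (h z) \<le> circle_sup_dist f g + circle_sup_dist g h"
        using circle_sup_dist_upper[OF f g z] circle_sup_dist_upper[OF g h z]
          dist_triangle[of "f z" "h z" "g z"] by linarith
    qed
    moreover have "log_deriv_dist f h \<le> log_deriv_dist f g + log_deriv_dist g h"
    proof (rule log_deriv_dist_least)
      fix x
      show "\<bar>log_deriv f x - log_deriv h x\<bar> \<le> log_deriv_dist f g + log_deriv_dist g h"
        using log_deriv_dist_upper[OF f g, of x] log_deriv_dist_upper[OF g h, of x] by linarith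
    qed
    ultimately show ?thesis by (simp add: log_rho_def f g h)
  qed
qed

lemma log_rho_right_mult_le:
  assumes f: "f \<in> diff1_plus" and g: "g \<in> diff1_plus" and h: "h \<in> diff1_plus"
  shows "log_rho (f \<otimes>\<^bsub>Diff1_plus\<^esub> h) (g \<otimes>\<^bsub>Diff1_plus\<^esub> h) \<le> log_rho f g"
proof -
  interpret group Diff1_plus by (rule group_Diff1_plus)
  have fh: "compose circle f h \<in> diff1_plus" and gh: "compose circle g h \<in> diff1_plus"
    using m_closed[of f h] m_closed[of g h] f g h by (simp_all add: mult_Diff1_plus)
  obtain H where H: "diffeo_lift h H (circle_deriv h)" using diff1_plus_lift[OF h] .
  have "circle_sup_dist (compose circle f h) (compose circle g h) \<le> circle_sup_dist f g"
    by (rule circle_sup_dist_least)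
      (simp add: compose_def circle_sup_dist_upper f g h diff1_plus_in_circle)
  moreover have "log_deriv_dist (compose circle f h) (compose circle g h) \<le> log_deriv_dist f g"
    by (rule log_deriv_dist_least)
      (simp add: log_deriv_compose[OF f H] log_deriv_compose[OF g H] log_deriv_dist_upper f g)
  ultimately show ?thesis by (simp add: mult_Diff1_plus f g h fh gh log_rho_def)
qed

text \<open>The inequality suffices: translating back by the inverse gives the converse.\<close>

lemma log_rho_right_invariant:
  assumes f: "f \<in> diff1_plus" and g: "g \<in> diff1_plus" and h: "h \<in> diff1_plus"
  shows "log_rho (f \<otimes>\<^bsub>Diff1_plus\<^esub> h) (g \<otimes>\<^bsub>Diff1_plus\<^esub> h) = log_rho f g"
proof (rule antisym[OF log_rho_right_mult_le[OF assms]])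
  interpret group Diff1_plus by (rule group_Diff1_plus)
  let ?k = "inv\<^bsub>Diff1_plus\<^esub> h"
  have mem: "f \<otimes>\<^bsub>Diff1_plus\<^esub> h \<in> diff1_plus" "g \<otimes>\<^bsub>Diff1_plus\<^esub> h \<in> diff1_plus" "?k \<in> diff1_plus"
    using m_closed[of f h] m_closed[of g h] inv_closed[of h] assms by simp_all
  have "(f \<otimes>\<^bsub>Diff1_plus\<^esub> h) \<otimes>\<^bsub>Diff1_plus\<^esub> ?k = f" "(g \<otimes>\<^bsub>Diff1_plus\<^esub> h) \<otimes>\<^bsub>Diff1_plus\<^esub> ?k = g"
    using assms[folded carrier_Diff1_plus] by (simp_all add: m_assoc del: carrier_Diff1_plus)
  then show "log_rho f g \<le> log_rho (f \<otimes>\<^bsub>Diff1_plus\<^esub> h) (g \<otimes>\<^bsub>Diff1_plus\<^esub> h)"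
    using log_rho_right_mult_le[OF mem] by simp
qed

lemma mtopology_subset:
  assumes "Metric_space M d" "Metric_space M d'"
    and small: "\<And>x \<epsilon>. x \<in> M \<Longrightarrow> 0 < \<epsilon> \<Longrightarrow> \<exists>\<delta>>0. \<forall>y\<in>M. d x y < \<delta> \<longrightarrow> d' x y < \<epsilon>"
    and U: "openin (Metric_space.mtopology M d') U"
  shows "openin (Metric_space.mtopology M d) U"
proof -
  interpret d: Metric_space M d by fact
  interpret d': Metric_space M d' by fact
  show ?thesis
    unfolding d.openin_mtopology
  proof (intro conjI allI impI)
    show UM: "U \<subseteq> M" using U d'.openin_mtopology by blast
    fix x assume x: "x \<in> U"
    then obtain \<epsilon> where e: "0 < \<epsilon>" "d'.mball x \<epsilon> \<subseteq> U" using U d'.openin_mtopology by blast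
    then obtain \<delta> where "0 < \<delta>" "\<forall>y\<in>M. d x y < \<delta> \<longrightarrow> d' x y < \<epsilon>" using small x UM by blast
    then have "d.mball x \<delta> \<subseteq> U" using e(2) by auto
    then show "\<exists>r>0. d.mball x r \<subseteq> U" using \<open>0 < \<delta>\<close> by blast
  qed
qed

lemma rho1_bounds:
  assumes f: "f \<in> diff1_plus" and g: "g \<in> diff1_plus"
  shows "rho1 f g < \<delta> \<Longrightarrow> \<bar>circle_deriv f x - circle_deriv g x\<bar> < \<delta>"
    and "rho1 f g < \<delta> \<Longrightarrow> circle_sup_dist f g < \<delta>"
    and "(\<And>x. \<bar>circle_deriv f x - circle_deriv g x\<bar> \<le> b) \<Longrightarrow> rho1 f g \<le> circle_sup_dist f g + b"
proof -
  define B where "B = (SUP x\<in>{0..1}. \<bar>circle_deriv f x - circle_deriv g x\<bar>)"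
  have rho: "rho1 f g = circle_sup_dist f g + B"
    by (simp add: rho1_def f g circle_sup_dist_def B_def)
  have "compact ((\<lambda>x. \<bar>circle_deriv f x - circle_deriv g x\<bar>) ` {0..1})"
    using f g by (intro compact_continuous_image continuous_intros continuous_on_circle_deriv) auto
  then have "bdd_above ((\<lambda>x. \<bar>circle_deriv f x - circle_deriv g x\<bar>) ` {0..1})"
    by (intro bounded_imp_bdd_above compact_imp_bounded)
  then have "\<bar>circle_deriv f (frac x) - circle_deriv g (frac x)\<bar> \<le> B" for x
    unfolding B_def by (intro cSUP_upper frac_mem)
  then have B: "\<bar>circle_deriv f x - circle_deriv g x\<bar> \<le> B" for x
    using circle_deriv_frac f g by metis
  have "0 \<le> B" using B order_trans abs_ge_zero by blast
  then show "rho1 f g < \<delta> \<Longrightarrow> circle_sup_dist f g < \<delta>" using rho by simp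
  show "rho1 f g < \<delta> \<Longrightarrow> \<bar>circle_deriv f x - circle_deriv g x\<bar> < \<delta>"
    using rho B[of x] circle_sup_dist_nonneg[OF f g] by linarith
  show "rho1 f g \<le> circle_sup_dist f g + b"
    if "\<And>x. \<bar>circle_deriv f x - circle_deriv g x\<bar> \<le> b"
  proof -
    have "B \<le> b" unfolding B_def by (rule cSUP_least) (use that in auto)
    then show ?thesis using rho by simp
  qed
qed

lemma abs_ln_diff_le:
  fixes a b m :: real
  assumes "0 < m" "m \<le> a" "m \<le> b"
  shows "\<bar>ln a - ln b\<bar> \<le> \<bar>a - b\<bar> / m"
proof -
  have *: "ln a - ln b \<le> \<bar>a - b\<bar> / m" if "0 < m" "m \<le> a" "m \<le> b" for a b :: real
  proof -
    have "ln a - ln b \<le> (a - b) / b" using that by (intro ln_diff_le) auto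
    also have "\<dots> \<le> \<bar>a - b\<bar> / m" using that by (intro frac_le) auto
    finally show ?thesis .
  qed
  show ?thesis using *[of a b] *[of b a] assms by (simp add: abs_le_iff abs_minus_commute)
qed

lemma abs_diff_le_of_ln:
  fixes a b :: real
  assumes "0 < a" "0 < b" "\<bar>ln a - ln b\<bar> \<le> \<delta>" "\<delta> \<le> 1"
  shows "\<bar>a - b\<bar> \<le> 2 * \<delta> * a"
proof -
  have d: "0 \<le> \<delta>" using assms by linarith
  have "exp \<delta> \<le> 1 + \<delta> + \<delta>\<^sup>2" by (rule exp_bound[OF d assms(4)])
  also have "\<delta>\<^sup>2 \<le> \<delta>" using d assms(4) by (simp add: power2_eq_square mult_left_le)
  finally have e: "exp \<delta> \<le> 1 + 2 * \<delta>" by simp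
  have "b \<le> a * exp \<delta>"
  proof -
    have "b = exp (ln b)" using assms by simp
    also have "\<dots> \<le> exp (ln a + \<delta>)" using assms(3) unfolding exp_le_cancel_iff by linarith
    also have "\<dots> = a * exp \<delta>" using assms by (simp add: exp_add)
    finally show ?thesis .
  qed
  also have "\<dots> \<le> a * (1 + 2 * \<delta>)" using assms e by (intro mult_left_mono) auto
  finally have 1: "b - a \<le> 2 * \<delta> * a" by (simp add: algebra_simps)
  have "a * (1 - 2 * \<delta>) \<le> a * exp (- \<delta>)"
    using assms d exp_ge_add_one_self[of "- \<delta>"] by (intro mult_left_mono) auto
  also have "\<dots> = exp (ln a - \<delta>)" using assms by (simp add: exp_diff exp_minus field_simps)
  also have "\<dots> \<le> exp (ln b)" using assms(3) unfolding exp_le_cancel_iff by linarith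
  finally have "a - b \<le> 2 * \<delta> * a" using assms by (simp add: algebra_simps)
  then show ?thesis using 1 by linarith
qed

text \<open>The derivative of a fixed \<open>f\<close> lies between two positive constants, and on such a range the
  logarithm and the exponential are Lipschitz.  The comparison is local: the constants depend on \<open>f\<close>.\<close>

lemma mtopology_log_rho: "Metric_space.mtopology diff1_plus log_rho = Diff1_topology"
proof -
  have bounds: "\<exists>m M. 0 < m \<and> 0 < M \<and> (\<forall>x. m \<le> circle_deriv f x \<and> circle_deriv f x \<le> M)"
    if f: "f \<in> diff1_plus" for f
  proof -
    obtain B where B: "\<And>x. \<bar>log_deriv f x\<bar> \<le> B" using log_deriv_bounded[OF f] by blast
    have eq: "circle_deriv f x = exp (log_deriv f x)" for x
      using circle_deriv_pos[OF f] by (simp add: log_deriv_def)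
    have "exp (- B) \<le> circle_deriv f x \<and> circle_deriv f x \<le> exp B" for x
      using B[of x] unfolding eq exp_le_cancel_iff by linarith
    then show ?thesis by (intro exI[of _ "exp (- B)"] exI[of _ "exp B"]) auto
  qed
  have 1: "\<exists>\<delta>>0. \<forall>g\<in>diff1_plus. log_rho f g < \<delta> \<longrightarrow> rho1 f g < \<epsilon>"
    if f: "f \<in> diff1_plus" and e: "0 < \<epsilon>" for f \<epsilon>
  proof -
    obtain M where M: "0 < M" "\<And>x. circle_deriv f x \<le> M" using bounds[OF f] by blast
    define \<delta> where "\<delta> = min 1 (\<epsilon> / (2 * (1 + 2 * M)))"
    have d: "0 < \<delta>" "\<delta> \<le> 1" "\<delta> \<le> \<epsilon> / (2 * (1 + 2 * M))" using e M by (auto simp: \<delta>_def)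
    then have d3: "\<delta> * (1 + 2 * M) \<le> \<epsilon> / 2" using M(1) by (simp add: field_simps)
    have "rho1 f g < \<epsilon>" if g: "g \<in> diff1_plus" and lt: "log_rho f g < \<delta>" for g
    proof -
      have parts: "circle_sup_dist f g \<le> \<delta>" "log_deriv_dist f g \<le> \<delta>"
        using lt circle_sup_dist_nonneg[OF f g] log_deriv_dist_nonneg[OF f g]
        by (auto simp: log_rho_def f g)
      have "\<bar>circle_deriv f x - circle_deriv g x\<bar> \<le> 2 * \<delta> * M" for x
      proof -
        have "\<bar>circle_deriv f x - circle_deriv g x\<bar> \<le> 2 * \<delta> * circle_deriv f x"
          using log_deriv_dist_upper[OF f g, of x] parts(2) d(2) circle_deriv_pos[OF f]
            circle_deriv_pos[OF g]
          by (intro abs_diff_le_of_ln) (auto simp: log_deriv_def)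
        also have "\<dots> \<le> 2 * \<delta> * M" using d M(2) by (intro mult_left_mono) auto
        finally show ?thesis .
      qed
      then have "rho1 f g \<le> circle_sup_dist f g + 2 * \<delta> * M" by (rule rho1_bounds(3)[OF f g])
      also have "\<dots> \<le> \<delta> * (1 + 2 * M)" using parts by (simp add: algebra_simps)
      finally show ?thesis using d3 e by linarith
    qed
    then show ?thesis using d(1) by blast
  qed
  have 2: "\<exists>\<delta>>0. \<forall>g\<in>diff1_plus. rho1 f g < \<delta> \<longrightarrow> log_rho f g < \<epsilon>"
    if f: "f \<in> diff1_plus" and e: "0 < \<epsilon>" for f \<epsilon>
  proof -
    obtain m where m: "0 < m" "\<And>x. m \<le> circle_deriv f x" using bounds[OF f] by blast
    define \<delta> where "\<delta> = min (m / 2) (\<epsilon> / (2 * (1 + 2 / m)))"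
    have "0 < \<delta>" using e m(1) by (auto simp: \<delta>_def intro!: divide_pos_pos add_pos_pos)
    then have d: "0 < \<delta>" "\<delta> \<le> m / 2" "\<delta> \<le> \<epsilon> / (2 * (1 + 2 / m))"
      unfolding \<delta>_def by linarith+
    have "0 < 2 * (1 + 2 / m)" using m(1) by (simp add: add_pos_pos)
    then have "\<delta> * (2 * (1 + 2 / m)) \<le> \<epsilon>" using d(3) by (simp add: pos_le_divide_eq)
    then have d3: "\<delta> + 2 * \<delta> / m \<le> \<epsilon> / 2" by (simp add: algebra_simps)
    have "log_rho f g < \<epsilon>" if g: "g \<in> diff1_plus" and lt: "rho1 f g < \<delta>" for g
    proof -
      have "log_deriv_dist f g \<le> 2 * \<delta> / m"
      proof (rule log_deriv_dist_least)
        fix x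
        have c: "\<bar>circle_deriv f x - circle_deriv g x\<bar> < \<delta>" by (rule rho1_bounds(1)[OF f g lt])
        then have "m / 2 \<le> circle_deriv g x" "m / 2 \<le> circle_deriv f x"
          using m(2)[of x] d(2) m(1) by linarith+
        then have "\<bar>log_deriv f x - log_deriv g x\<bar>
            \<le> \<bar>circle_deriv f x - circle_deriv g x\<bar> / (m / 2)"
          unfolding log_deriv_def using m(1) by (intro abs_ln_diff_le) auto
        also have "\<dots> \<le> \<delta> / (m / 2)" using c m(1) by (intro divide_right_mono) auto
        finally show "\<bar>log_deriv f x - log_deriv g x\<bar> \<le> 2 * \<delta> / m" by (simp add: mult.commute)
      qed
      then show ?thesis
        using rho1_bounds(2)[OF f g lt] d3 e by (simp add: log_rho_def f g)
    qed
    then show ?thesis using d(1) by blast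
  qed
  show ?thesis
    unfolding Diff1_topology_def topology_eq
    using mtopology_subset[OF Metric_space_log_rho Metric_space_rho1 1]
      mtopology_subset[OF Metric_space_rho1 Metric_space_log_rho 2] by blast
qed

lemma compatible_log_rho: "compatible_right_invariant_metric Diff1_plus Diff1_topology log_rho"
  unfolding compatible_right_invariant_metric_def
  using Metric_space_log_rho mtopology_log_rho log_rho_right_invariant by simp


section \<open>Short steps towards a diffeomorphism\<close>

text \<open>Two diffeomorphisms are close when their lifts agree approximately at \<open>0\<close> and their logarithmic
  derivatives differ by a nearly constant function.  With \<open>\<delta> = 0\<close> and equal lifts at \<open>0\<close> this is
  uniqueness of the diffeomorphism with given logarithmic derivative up to constants.\<close>

lemma log_rho_le_oscillation:
  assumes f: "f \<in> diff1_plus" and F: "diffeo_lift f F (circle_deriv f)"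
    and g: "g \<in> diff1_plus" and G: "diffeo_lift g G (circle_deriv g)"
    and osc: "\<And>x y. \<bar>(log_deriv f x - log_deriv g x) - (log_deriv f y - log_deriv g y)\<bar> \<le> \<delta>"
  shows "log_rho f g \<le> 2 * pi * (\<bar>F 0 - G 0\<bar> + (exp \<delta> - 1)) + \<delta>"
proof -
  have diff: "\<bar>log_deriv f x - log_deriv g x\<bar> \<le> \<delta>" for x
    by (rule log_deriv_diff_le_oscillation[OF f g osc])
  then have d: "1 \<le> exp \<delta>" using abs_ge_zero order_trans by (metis one_le_exp_iff)
  have le: "circle_deriv f x \<le> exp \<delta> * circle_deriv g x"
    if f: "f \<in> diff1_plus" and g: "g \<in> diff1_plus"
      and diff: "\<bar>log_deriv f x - log_deriv g x\<bar> \<le> \<delta>" for f g x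
  proof -
    have "circle_deriv f x = exp (log_deriv f x)"
      using circle_deriv_pos[OF f] by (simp add: log_deriv_def)
    also have "\<dots> \<le> exp (\<delta> + log_deriv g x)" using diff unfolding exp_le_cancel_iff by linarith
    also have "\<dots> = exp \<delta> * circle_deriv g x"
      using circle_deriv_pos[OF g] by (simp add: log_deriv_def exp_add)
    finally show ?thesis .
  qed
  have "circle_sup_dist f g \<le> 2 * pi * (\<bar>F 0 - G 0\<bar> + (exp \<delta> - 1))"
  proof (rule circle_sup_dist_least)
    fix z assume "z \<in> circle"
    then obtain x where x: "0 \<le> x" "x < 1" "circle_point x = z" by (rule circle_point_surj)
    have "(F x - F 0) - (G x - G 0) \<le> exp \<delta> - 1"
      by (rule diffeo_lift_growth_le[OF F G le[OF f g diff] d]) (use x in auto)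
    moreover have "(G x - G 0) - (F x - F 0) \<le> exp \<delta> - 1"
      by (rule diffeo_lift_growth_le[OF G F le[OF g f] d])
        (use x diff in \<open>auto simp: abs_minus_commute\<close>)
    ultimately have "\<bar>F x - G x\<bar> \<le> \<bar>F 0 - G 0\<bar> + (exp \<delta> - 1)" by linarith
    moreover have "dist (f z) (g z) \<le> 2 * pi * \<bar>F x - G x\<bar>"
      unfolding x(3)[symmetric] diffeo_liftD(5)[OF F] diffeo_liftD(5)[OF G]
      by (rule dist_circle_point_le)
    ultimately show "dist (f z) (g z) \<le> 2 * pi * (\<bar>F 0 - G 0\<bar> + (exp \<delta> - 1))"
      by (smt (verit) mult_left_mono pi_gt_zero)
  qed
  moreover have "log_deriv_dist f g \<le> \<delta>" by (rule log_deriv_dist_least[OF diff])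
  ultimately show ?thesis by (simp add: log_rho_def f g)
qed

text \<open>The path scales the logarithmic derivative of \<open>h\<close> and the rotation part \<open>H 0\<close> of its lift
  simultaneously by \<open>t\<close>.  Up to the normalising constants it is the preimage of a straight segment in
  function space, so its speed is controlled by the distance of \<open>h\<close> from the identity.\<close>

lemma diff1_plus_path:
  assumes h: "h \<in> diff1_plus"
  obtains p P where "\<And>t. p t \<in> diff1_plus" "\<And>t. diffeo_lift (p t) (P t) (circle_deriv (p t))"
    "p 0 = (\<lambda>z\<in>circle. z)" "p 1 = h" "\<And>s t. \<bar>P s 0 - P t 0\<bar> \<le> \<bar>s - t\<bar>"
    "\<And>s t x y. \<bar>(log_deriv (p s) x - log_deriv (p t) x) - (log_deriv (p s) y - log_deriv (p t) y)\<bar>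
       \<le> 2 * \<bar>s - t\<bar> * log_rho h (\<lambda>z\<in>circle. z)"
proof -
  let ?e = "\<lambda>z\<in>circle. z"
  have e: "?e \<in> diff1_plus" using diffeo_lift_id by (auto simp: diff1_plus_iff)
  have e_lift: "diffeo_lift ?e (\<lambda>x. x) (circle_deriv ?e)"
    using diffeo_lift_id circle_deriv_eq[OF diffeo_lift_id] by metis
  define u where "u = log_deriv h"
  have u: "continuous_on UNIV u" "\<And>x. u (x + 1) = u x"
    using continuous_on_log_deriv[OF h] circle_deriv_periodic[OF h] by (auto simp: u_def log_deriv_def)
  have u_le: "\<bar>u x\<bar> \<le> log_rho h ?e" for x
    using log_deriv_dist_upper[OF h e, of x] circle_sup_dist_nonneg[OF h e]
    by (simp add: log_deriv_one u_def log_rho_def h e)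
  obtain H0 where H0: "diffeo_lift h H0 (circle_deriv h)" using diff1_plus_lift[OF h] .
  define H where "H x = H0 x - of_int \<lfloor>H0 0\<rfloor>" for x
  have H: "diffeo_lift h H (circle_deriv h)" unfolding H_def by (rule diffeo_lift_shift[OF H0])
  have H_0: "0 \<le> H 0" "H 0 \<le> 1" unfolding H_def by linarith+
  have "\<exists>f F Z. f \<in> diff1_plus \<and> diffeo_lift f F (circle_deriv f) \<and> F 0 = t * H 0 \<and>
      (\<forall>x. log_deriv f x = t * u x - Z)" for t
    by (rule diff1_plus_with_log_deriv[of "\<lambda>x. t * u x" "t * H 0"])
      (use u in \<open>auto intro!: continuous_intros\<close>)
  then obtain p P Z where p: "\<And>t. p t \<in> diff1_plus" "\<And>t. diffeo_lift (p t) (P t) (circle_deriv (p t))"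
    "\<And>t. P t 0 = t * H 0" "\<And>t x. log_deriv (p t) x = t * u x - Z t"
    by metis
  have eqI: "f = g" if "f \<in> diff1_plus" "g \<in> diff1_plus" "log_rho f g \<le> 0" for f g
    using that Metric_space.zero[OF Metric_space_log_rho] Metric_space.nonneg[OF Metric_space_log_rho]
    by (metis order_antisym)
  show thesis
  proof (rule that[of p P])
    have "log_rho (p 0) ?e \<le> 2 * pi * (\<bar>P 0 0 - 0\<bar> + (exp 0 - 1)) + 0"
      by (rule log_rho_le_oscillation[OF p(1,2) e e_lift]) (simp add: p(4) log_deriv_one)
    then show "p 0 = ?e" by (intro eqI p(1) e) (simp add: p(3))
    have "log_rho (p 1) h \<le> 2 * pi * (\<bar>P 1 0 - H 0\<bar> + (exp 0 - 1)) + 0"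
      by (rule log_rho_le_oscillation[OF p(1,2) h H]) (simp add: p(4) u_def)
    then show "p 1 = h" by (intro eqI p(1) h) (simp add: p(3))
    show "\<bar>P s 0 - P t 0\<bar> \<le> \<bar>s - t\<bar>" for s t
      using H_0 mult_left_mono[of "H 0" 1 "\<bar>s - t\<bar>"]
      by (simp add: p(3) left_diff_distrib[symmetric] abs_mult)
    show "\<bar>(log_deriv (p s) x - log_deriv (p t) x) - (log_deriv (p s) y - log_deriv (p t) y)\<bar>
       \<le> 2 * \<bar>s - t\<bar> * log_rho h ?e" for s t x y
    proof -
      have "(log_deriv (p s) x - log_deriv (p t) x) - (log_deriv (p s) y - log_deriv (p t) y)
          = (s - t) * (u x - u y)"
        by (simp add: p(4) algebra_simps)
      also have "\<bar>\<dots>\<bar> = \<bar>s - t\<bar> * \<bar>u x - u y\<bar>" by (rule abs_mult)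
      also have "\<dots> \<le> \<bar>s - t\<bar> * (2 * log_rho h ?e)"
        using u_le[of x] u_le[of y] by (intro mult_left_mono) auto
      finally show ?thesis by simp
    qed
  qed (rule p)+
qed

text \<open>Cut the path from the identity to \<open>h\<close> into \<open>n\<close> equal pieces.  With \<open>R\<close> the distance of \<open>h\<close> from the
  identity, each piece has length at most a constant multiple of \<open>(R + 1) / n\<close>, so that \<open>n\<close> may be taken
  linear in \<open>R\<close>.\<close>

lemma large_scale_geodesic_log_rho: "large_scale_geodesic Diff1_plus log_rho"
  unfolding large_scale_geodesic_def one_Diff1_plus carrier_Diff1_plus
proof (intro allI impI)
  fix \<epsilon> :: real assume e: "0 < \<epsilon>"
  let ?e = "\<lambda>z\<in>circle. z"
  define K where "K = 28 / \<epsilon> + 2"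
  have "\<exists>n c. real n \<le> K * log_rho h ?e + K \<and> c \<in> UNIV \<rightarrow> diff1_plus \<and> c 0 = ?e \<and> c n = h \<and>
      (\<forall>i<n. log_rho (c (Suc i)) (c i) < \<epsilon>)" if h: "h \<in> diff1_plus" for h
  proof -
    define R where "R = log_rho h ?e"
    have R: "0 \<le> R" unfolding R_def by (rule Metric_space.nonneg[OF Metric_space_log_rho])
    obtain p P where p: "\<And>t. p t \<in> diff1_plus" "\<And>t. diffeo_lift (p t) (P t) (circle_deriv (p t))"
      "p 0 = ?e" "p 1 = h" "\<And>s t. \<bar>P s 0 - P t 0\<bar> \<le> \<bar>s - t\<bar>"
      "\<And>s t x y. \<bar>(log_deriv (p s) x - log_deriv (p t) x) - (log_deriv (p s) y - log_deriv (p t) y)\<bar>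
       \<le> 2 * \<bar>s - t\<bar> * R"
      using diff1_plus_path[OF h] unfolding R_def by metis
    \<comment> \<open>The first summand makes the steps shorter than \<open>\<epsilon>\<close>; the second keeps the oscillation
        \<open>2 R / n\<close> of a step below 1, where \<open>exp \<delta> - 1 \<le> 2 \<delta>\<close>.\<close>
    define n where "n = nat \<lceil>28 * (R + 1) / \<epsilon> + 2 * R\<rceil> + 1"
    define c where "c i = p (real i / real n)" for i
    have nonneg: "0 \<le> 28 * (R + 1) / \<epsilon>" using R e by simp
    have n: "28 * (R + 1) / \<epsilon> + 2 * R < real n" "real n \<le> 28 * (R + 1) / \<epsilon> + 2 * R + 2" "0 < n"
      unfolding n_def using nonneg R by linarith+
    then have n_gt: "28 * (R + 1) / \<epsilon> < real n" "2 * R \<le> real n" using nonneg R by linarith+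
    have "28 * (R + 1) < \<epsilon> * real n" using n_gt(1) e by (simp add: field_simps)
    then have small: "28 * (R + 1) / real n < \<epsilon>" using n(3) by (simp add: field_simps)
    have "log_rho (c (Suc i)) (c i) < \<epsilon>" for i
    proof -
      define s t where "s = real (Suc i) / real n" and "t = real i / real n"
      have st: "\<bar>s - t\<bar> = 1 / real n"
        using n(3) by (simp add: s_def t_def diff_divide_distrib[symmetric])
      define \<delta> where "\<delta> = 2 * (1 / real n) * R"
      have d: "0 \<le> \<delta>" "\<delta> \<le> 1" using R n_gt(2) n(3) by (auto simp: \<delta>_def divide_le_eq)
      have "exp \<delta> \<le> 1 + \<delta> + \<delta>\<^sup>2" by (rule exp_bound[OF d])
      also have "\<delta>\<^sup>2 \<le> \<delta>" using d by (simp add: power2_eq_square mult_left_le)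
      finally have ex: "exp \<delta> - 1 \<le> 2 * \<delta>" by simp
      have "log_rho (p s) (p t) \<le> 2 * pi * (\<bar>P s 0 - P t 0\<bar> + (exp \<delta> - 1)) + \<delta>"
        using p(6)[of s _ t] unfolding st \<delta>_def[symmetric]
        by (intro log_rho_le_oscillation[OF p(1,2) p(1,2)])
      also have "\<dots> \<le> 2 * pi * (1 / real n + 2 * \<delta>) + \<delta>"
        using p(5)[of s t] ex unfolding st by (intro add_right_mono mult_left_mono add_mono) auto
      \<comment> \<open>The total is at most \<open>2 \<pi> / n + (4 \<pi> + 1) \<delta>\<close>, which \<open>\<pi> \<le> 3.2\<close> turns into \<open>(6.4 + 27.6 R) / n\<close>.\<close>
      also have "\<dots> \<le> 2 * 3.2 * (1 / real n + 2 * \<delta>) + \<delta>"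
        using pi_approx d n(3) by (intro add_right_mono mult_right_mono) auto
      also have "\<dots> = (6.4 + 27.6 * R) / real n"
        by (simp add: \<delta>_def add_divide_distrib algebra_simps)
      also have "\<dots> \<le> 28 * (R + 1) / real n" using R by (intro divide_right_mono) auto
      finally show ?thesis using small by (simp add: c_def s_def t_def)
    qed
    moreover have "real n \<le> K * R + K"
      using n(2) by (simp add: K_def algebra_simps add_divide_distrib)
    moreover have "c 0 = ?e" "c n = h" "c \<in> UNIV \<rightarrow> diff1_plus"
      using n(3) p(1,3,4) by (auto simp: c_def)
    ultimately show ?thesis unfolding R_def by blast
  qed
  moreover have "0 \<le> K" using e by (simp add: K_def)
  ultimately show "\<exists>K\<ge>0. \<forall>h\<in>diff1_plus. \<exists>n c. real n \<le> K * log_rho h ?e + K \<and>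
      c \<in> UNIV \<rightarrow> diff1_plus \<and> c 0 = ?e \<and> c n = h \<and> (\<forall>i<n. log_rho (c (Suc i)) (c i) < \<epsilon>)"
    by blast
qed


section \<open>The map to function space\<close>

lemma mspace_Z_space:
  "mspace Z_space =
     {F \<in> extensional {0..1}. continuous_on {0..1} F \<and> F 0 = 0 \<and> F 1 = 0}"
proof -
  have "bounded (F ` {0..1::real})" if "continuous_on {0..1} F" for F :: "real \<Rightarrow> real"
    using that by (intro compact_imp_bounded compact_continuous_image) auto
  then show ?thesis
    by (auto simp: Z_space_def C01_def)
qed

lemma Phi1_eq: "x \<in> {0..1} \<Longrightarrow> Phi1 f x = log_deriv f x - log_deriv f 0"
  by (simp add: Phi1_def log_deriv_def)

lemma Phi1_in_Z_space:
  assumes f: "f \<in> diff1_plus"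
  shows "Phi1 f \<in> mspace Z_space"
proof -
  have "continuous_on {0..1} (\<lambda>x. log_deriv f x - log_deriv f 0)"
    using f by (intro continuous_intros continuous_on_log_deriv)
  then have "continuous_on {0..1} (Phi1 f)"
    by (rule continuous_on_cong[THEN iffD1, rotated 2]) (simp_all add: Phi1_eq)
  moreover have "Phi1 f 1 = 0"
    using circle_deriv_periodic[OF f, of 0] by (simp add: Phi1_def)
  ultimately show ?thesis by (simp add: mspace_Z_space Phi1_def)
qed

lemma mdist_Z_space_upper:
  assumes "F \<in> mspace Z_space" "G \<in> mspace Z_space" "x \<in> {0..1}"
  shows "\<bar>F x - G x\<bar> \<le> mdist Z_space F G"
  using mdist_cfunspace_imp_mdist_le[of F "top_of_set {0..1}" euclidean_metric G _ x] assms
  by (auto simp: Z_space_def C01_def dist_real_def)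

lemma mdist_Z_space_least:
  assumes "\<And>x. x \<in> {0..1} \<Longrightarrow> \<bar>F x - G x\<bar> \<le> b"
  shows "mdist Z_space F G \<le> b"
proof -
  have "0 \<le> b" using assms[of 0] by simp
  then show ?thesis
    using assms mdist_cfunspace_le[of b "top_of_set {0..1}" euclidean_metric F G]
    by (auto simp: Z_space_def C01_def dist_real_def)
qed

lemma mdist_Phi1_le:
  assumes f: "f \<in> diff1_plus" and g: "g \<in> diff1_plus"
  shows "mdist Z_space (Phi1 f) (Phi1 g) \<le> 2 * log_rho f g"
proof (rule mdist_Z_space_least)
  fix x :: real assume x: "x \<in> {0..1}"
  show "\<bar>Phi1 f x - Phi1 g x\<bar> \<le> 2 * log_rho f g"
    using log_deriv_dist_upper[OF f g, of x] log_deriv_dist_upper[OF f g, of 0]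
      circle_sup_dist_nonneg[OF f g]
    unfolding Phi1_eq[OF x] log_rho_def by (simp add: f g)
qed

text \<open>The distance of \<open>\<Phi>\<^sub>1 f\<close> and \<open>\<Phi>\<^sub>1 g\<close> controls the oscillation of the difference of the
  logarithmic derivatives, hence its size.  The positions on the circle contribute at most its
  diameter 2.\<close>

lemma log_rho_le_mdist_Phi1:
  assumes f: "f \<in> diff1_plus" and g: "g \<in> diff1_plus"
  shows "log_rho f g \<le> 2 * mdist Z_space (Phi1 f) (Phi1 g) + 2"
proof -
  let ?m = "mdist Z_space (Phi1 f) (Phi1 g)"
  have Phi: "\<bar>(log_deriv f x - log_deriv f 0) - (log_deriv g x - log_deriv g 0)\<bar> \<le> ?m" for x
    using mdist_Z_space_upper[OF Phi1_in_Z_space[OF f] Phi1_in_Z_space[OF g] frac_mem[of x]]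
    by (simp add: Phi1_eq[OF frac_mem] log_deriv_frac f g)
  have "log_deriv_dist f g \<le> 2 * ?m"
  proof (rule log_deriv_dist_least[OF log_deriv_diff_le_oscillation[OF f g]])
    fix x y
    show "\<bar>(log_deriv f x - log_deriv g x) - (log_deriv f y - log_deriv g y)\<bar> \<le> 2 * ?m"
      using Phi[of x] Phi[of y] by linarith
  qed
  moreover have "circle_sup_dist f g \<le> 2"
    using f g by (intro circle_sup_dist_least diff1_plus_dist_le_2)
  ultimately show ?thesis by (simp add: log_rho_def f g)
qed

lemma Phi1_surj:
  assumes F: "F \<in> mspace Z_space"
  obtains f where "f \<in> diff1_plus" "Phi1 f = F"
proof -
  have F': "continuous_on {0..1} F" "F 0 = F 1" "F \<in> extensional {0..1}" "F 0 = 0"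
    using F by (auto simp: mspace_Z_space)
  obtain u where u: "continuous_on UNIV u" "\<And>x. u (x + 1) = u x" "\<And>x. x \<in> {0..1} \<Longrightarrow> u x = F x"
    using periodic_extension[OF F'(1,2)] by metis
  obtain f Z where f: "f \<in> diff1_plus" "\<And>x. log_deriv f x = u x - Z"
    using diff1_plus_with_log_deriv[OF u(1,2), of 0] by metis
  have "Phi1 f = F"
  proof (rule extensionalityI[of _ "{0..1}"])
    show "Phi1 f x = F x" if "x \<in> {0..1}" for x
      using that u(3)[of x] u(3)[of 0] F'(4) by (simp add: Phi1_eq f(2))
  qed (auto simp: F' Phi1_def)
  then show thesis using that f(1) by blast
qed

theorem Phi1_quasi_isometry_log_rho:
  "quasi_isometry diff1_plus log_rho (mspace Z_space) (mdist Z_space) Phi1"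
  unfolding quasi_isometry_def
proof (intro conjI exI[of _ 2] ballI)
  show "Phi1 \<in> diff1_plus \<rightarrow> mspace Z_space" using Phi1_in_Z_space by blast
  fix f g assume "f \<in> diff1_plus" "g \<in> diff1_plus"
  then show "1 / 2 * log_rho f g - 2 \<le> mdist Z_space (Phi1 f) (Phi1 g)"
    "mdist Z_space (Phi1 f) (Phi1 g) \<le> 2 * log_rho f g + 2"
    using mdist_Phi1_le log_rho_le_mdist_Phi1 by fastforce+
next
  fix F assume F: "F \<in> mspace Z_space"
  then obtain f where "f \<in> diff1_plus" "Phi1 f = F" by (rule Phi1_surj)
  moreover have "mdist Z_space F F \<le> 2" by (rule mdist_Z_space_least) simp
  ultimately show "\<exists>f\<in>diff1_plus. mdist Z_space F (Phi1 f) \<le> 2" by (intro bexI[of _ f]) auto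
qed simp_all

theorem theorem4p3:
  shows "(\<exists>d. represents_quasi_isometry_class Diff1_plus Diff1_topology d) \<and>
         (\<forall>d. represents_quasi_isometry_class Diff1_plus Diff1_topology d \<longrightarrow>
              quasi_isometry (carrier Diff1_plus) d (mspace Z_space) (mdist Z_space) Phi1)"
proof (intro conjI exI allI impI)
  show "represents_quasi_isometry_class Diff1_plus Diff1_topology log_rho"
    by (rule large_scale_geodesic_represents[OF group_Diff1_plus compatible_log_rho
          large_scale_geodesic_log_rho])
next
  fix d assume "represents_quasi_isometry_class Diff1_plus Diff1_topology d"
  then have "quasi_isometry diff1_plus d diff1_plus log_rho (\<lambda>f. f)"
    using represents_quasi_isometry_class_unique[OF group_Diff1_plus compatible_log_rho
        large_scale_geodesic_log_rho] by simp
  then show "quasi_isometry (carrier Diff1_plus) d (mspace Z_space) (mdist Z_space) Phi1"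
    using quasi_isometry_compose[OF _ Phi1_quasi_isometry_log_rho Metric_space_mspace_mdist] by simp
qed

end
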